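(* Let $n,k$ be positive integers with $2k<n$, let $a,b\in\mathbb{Z}$ be such that $F(x)=x^n+ax^{2k}+b$ is irreducible over $\mathbb{Q}$, and let $K=\mathbb{Q}(\alpha)$ where $\alpha$ is a root of $F(x)$. Let $p$ be an odd rational prime such that: (1) $p\nmid 2k(n-2k)$; (2) $p-1$ divides $n-2k$; (3) $\nu_p(b)\geq 1$ and $\nu_p(b)$ is even; (4) $a\equiv -b_p\equiv -1\pmod p$. Then $p$ divides $i(K)$. In particular, $K$ is not monogenic.
   Context: $\nu_p$ denotes the $p$-adic valuation, and for a nonzero integer $c$, $c_p=c/p^{\nu_p(c)}$. For a number field $K$ with ring of integers $\mathbb{Z}_K$, the index $i(K)$ is the greatest common divisor of the indices $(\mathbb{Z}_K:\mathbb{Z}[\theta])$ over all $\theta\in\mathbb{Z}_K$ generating $K$. $K$ is monogenic if $\mathbb{Z}_K=\mathbb{Z}[\theta]$ for some $\theta\in\mathbb{Z}_K$. *)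

theory Defs
  imports
    "HOL-Computational_Algebra.Computational_Algebra"
    "HOL-Number_Theory.Cong"
    "HOL-Library.Set_Algebras"
begin

definition is_subfield :: "'a::field set \<Rightarrow> bool" where
  "is_subfield L \<longleftrightarrow> 0 \<in> L \<and> 1 \<in> L \<and>
     (\<forall>x\<in>L. \<forall>y\<in>L. x + y \<in> L \<and> x * y \<in> L) \<and>
     (\<forall>x\<in>L. - x \<in> L \<and> inverse x \<in> L)"

text \<open>In characteristic 0 the prime field is \<open>\<rat>\<close>, so the smallest subfield
  containing \<open>x\<close> is \<open>\<rat>(x)\<close>.\<close>

definition rat_adjoin :: "'a::field_char_0 \<Rightarrow> 'a set" where
  "rat_adjoin x = is_subfield hull {x}"

definition int_adjoin :: "'a::field_char_0 \<Rightarrow> 'a set" where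
  "int_adjoin x = range (\<lambda>q :: int poly. poly (map_poly of_int q) x)"

definition ring_of_integers :: "'a::field_char_0 set \<Rightarrow> 'a set" where
  "ring_of_integers K = {x \<in> K. algebraic_int x}"

text \<open>The number of cosets \<open>x + B\<close> with \<open>x \<in> A\<close>, intended for additive subgroups \<open>B \<subseteq> A\<close>.
  An infinite index would give the value 0; for the orders \<open>\<int>[\<theta>]\<close> below, with \<open>\<theta>\<close> an
  integral generator of a number field, the index is always finite.\<close>

definition add_index :: "'a::ab_group_add set \<Rightarrow> 'a set \<Rightarrow> nat" where
  "add_index A B = card ((\<lambda>x. x +o B) ` A)"

definition field_index :: "'a::field_char_0 set \<Rightarrow> nat" where
  "field_index K =
     Gcd {add_index (ring_of_integers K) (int_adjoin \<theta>) | \<theta>.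
            \<theta> \<in> ring_of_integers K \<and> rat_adjoin \<theta> = K}"

definition monogenic :: "'a::field_char_0 set \<Rightarrow> bool" where
  "monogenic K \<longleftrightarrow> (\<exists>\<theta>\<in>ring_of_integers K. ring_of_integers K = int_adjoin \<theta>)"

definition prime_free_part :: "nat \<Rightarrow> int \<Rightarrow> int" where
  "prime_free_part p c = c div int p ^ multiplicity (int p) c"

definition trinomial :: "nat \<Rightarrow> nat \<Rightarrow> int \<Rightarrow> int \<Rightarrow> int poly" where
  "trinomial n m a b = monom 1 n + monom a m + [:b:]"

end

theory Submission
  imports Defs "Jordan_Normal_Form.Char_Poly" "HOL-Computational_Algebra.Field_as_Ring"
    "HOL-Number_Theory.Residues"
begin

text \<open>There are \<open>p + 1\<close> different ring homomorphisms \<open>\<int>\<^sub>K \<rightarrow> \<int>/p\<close>. A homomorphism is determined on \<open>\<int>[\<theta>]\<close> by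
  the image of \<open>\<theta>\<close>, so two of them agree on \<open>\<int>[\<theta>]\<close>; their difference is a nonzero additive map
  \<open>\<int>\<^sub>K \<rightarrow> \<int>/p\<close> killing \<open>\<int>[\<theta>]\<close>, and \<open>p\<close> divides the index.

  The homomorphisms come from roots of \<open>F\<close> in totally ramified extensions of \<open>\<int>\<^sub>p\<close>. Modulo \<open>p\<close> we have
  \<open>F = x\<^bsup>2k\<^esup> (x\<^bsup>n-2k\<^esup> - 1)\<close>, and every nonzero residue is a simple root of the second factor, giving \<open>p - 1\<close>
  roots in \<open>\<int>\<^sub>p\<close>. Write \<open>\<nu>\<^sub>p(b) = 2m\<close>, \<open>m/k = m'/k'\<close> in lowest terms, and \<open>\<rho>\<^bsup>k'\<^esup> = \<plusminus>p\<close>. Substituting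
  \<open>x = \<rho>\<^bsup>m'\<^esup> u\<close> and dividing by \<open>\<rho>\<^bsup>2km'\<^esup>\<close> turns \<open>F\<close> into a polynomial congruent to \<open>1 - u\<^bsup>2k\<^esup>\<close>, which has the
  simple roots \<open>\<plusminus>1\<close>. Two of the resulting homomorphisms are separated by the integral element
  \<open>\<delta> = \<alpha>\<^bsup>k'\<^esup> (\<alpha>\<^bsup>n-2k\<^esup> + a) / p\<^bsup>m'\<^esup>\<close>.\<close>

section \<open>Algebraic integers\<close>

abbreviation ieval :: "int poly \<Rightarrow> 'b::comm_ring_1 \<Rightarrow> 'b" where
  "ieval q x \<equiv> poly (map_poly of_int q) x"

lemma ieval_0: "ieval 0 x = 0"
  by simp

lemma ieval_1: "ieval 1 x = 1"
  by (simp add: map_poly_1)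

lemma ieval_pCons: "ieval (pCons c q) x = of_int c + x * ieval q x"
  by (cases "c = 0 \<and> q = 0") auto

lemma ieval_add: "ieval (q + r) x = ieval q x + ieval r x"
proof -
  have "map_poly of_int (q + r) = (map_poly of_int q + map_poly of_int r :: 'a poly)"
    by (intro poly_eqI) (simp add: coeff_map_poly)
  thus ?thesis by simp
qed

lemma ieval_smult: "ieval (Polynomial.smult c q) x = of_int c * ieval q x"
  by (induction q) (simp_all add: ieval_pCons algebra_simps)

lemma ieval_mult: "ieval (q * r) x = ieval q x * ieval r x"
  by (induction q) (simp_all add: ieval_pCons ieval_add ieval_smult algebra_simps)

lemma ieval_uminus: "ieval (- q) x = - ieval q x"
  using ieval_smult[of "-1" q x] by simp

lemma ieval_diff: "ieval (q - r) x = ieval q x - ieval r x"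
  using ieval_add[of q "- r" x] by (simp add: ieval_uminus)

lemma ieval_power: "ieval (q ^ m) x = ieval q x ^ m"
  by (induction m) (simp_all add: ieval_1 ieval_mult)

lemma ieval_monom: "ieval (Polynomial.monom c m) x = of_int c * x ^ m"
  by (simp add: map_poly_monom Polynomial.poly_monom)

lemmas ieval_simps = ieval_0 ieval_1 ieval_pCons ieval_add ieval_smult ieval_mult ieval_uminus
  ieval_diff ieval_power ieval_monom Polynomial.poly_monom

section \<open>Finitely generated modules and integrality\<close>

definition int_span :: "'a::comm_ring_1 set \<Rightarrow> 'a set" where
  "int_span B = range (\<lambda>c :: 'a \<Rightarrow> int. \<Sum>b\<in>B. of_int (c b) * b)"

lemma int_spanI: "(\<Sum>b\<in>B. of_int (c b) * b) \<in> int_span B"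
  unfolding int_span_def by (rule rangeI)

lemma int_span_base:
  assumes "finite B" "b \<in> B"
  shows "b \<in> int_span B"
proof -
  have "(\<Sum>b'\<in>B. of_int (if b' = b then 1 else 0) * b') = (\<Sum>b'\<in>B. if b' = b then b' else 0)"
    by (intro sum.cong) auto
  hence "b = (\<Sum>b'\<in>B. of_int (if b' = b then 1 else 0) * b')"
    using assms by simp
  thus ?thesis using int_spanI[of "\<lambda>b'. if b' = b then 1 else 0" B] by simp
qed

lemma int_span_add:
  assumes "x \<in> int_span B" "y \<in> int_span B"
  shows "x + y \<in> int_span B"
proof -
  obtain c d where "x = (\<Sum>b\<in>B. of_int (c b) * b)" "y = (\<Sum>b\<in>B. of_int (d b) * b)"
    using assms unfolding int_span_def by blast
  hence "x + y = (\<Sum>b\<in>B. of_int (c b + d b) * b)"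
    by (simp add: sum.distrib algebra_simps)
  thus ?thesis using int_spanI[of "\<lambda>b. c b + d b" B] by simp
qed

lemma int_span_scale:
  assumes "x \<in> int_span B"
  shows "of_int k * x \<in> int_span B"
proof -
  obtain c where "x = (\<Sum>b\<in>B. of_int (c b) * b)"
    using assms unfolding int_span_def by blast
  hence "of_int k * x = (\<Sum>b\<in>B. of_int (k * c b) * b)"
    by (simp add: sum_distrib_left algebra_simps)
  thus ?thesis using int_spanI[of "\<lambda>b. k * c b" B] by simp
qed

lemma int_span_0: "0 \<in> int_span B"
  unfolding int_span_def by (rule range_eqI[of _ _ "\<lambda>_. 0"]) simp

lemma int_span_sum: "(\<And>i. i \<in> I \<Longrightarrow> f i \<in> int_span B) \<Longrightarrow> sum f I \<in> int_span B"
  by (induction I rule: infinite_finite_induct) (auto intro: int_span_0 int_span_add)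

text \<open>The multiplier ring of the module spanned by \<open>B\<close>. Sums and polynomial
  expressions of algebraic integers are shown to be integral by placing them in one such
  ring.\<close>

definition stabilizer_ring :: "'a::comm_ring_1 set \<Rightarrow> 'a set" where
  "stabilizer_ring B = {z. \<forall>b\<in>int_span B. z * b \<in> int_span B}"

lemma stabilizer_ringI:
  assumes "\<And>b. b \<in> B \<Longrightarrow> z * b \<in> int_span B"
  shows "z \<in> stabilizer_ring B"
proof -
  have "z * (\<Sum>b\<in>B. of_int (c b) * b) \<in> int_span B" for c
  proof -
    have "z * (\<Sum>b\<in>B. of_int (c b) * b) = (\<Sum>b\<in>B. of_int (c b) * (z * b))"
      by (simp add: sum_distrib_left mult_ac)
    thus ?thesis using assms by (auto intro!: int_span_sum int_span_scale)
  qed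
  thus ?thesis unfolding stabilizer_ring_def int_span_def[of B] by blast
qed

lemma stabilizer_ring_add:
  "x \<in> stabilizer_ring B \<Longrightarrow> y \<in> stabilizer_ring B \<Longrightarrow> x + y \<in> stabilizer_ring B"
  unfolding stabilizer_ring_def by (auto simp: distrib_right intro: int_span_add)

lemma stabilizer_ring_mult:
  "x \<in> stabilizer_ring B \<Longrightarrow> y \<in> stabilizer_ring B \<Longrightarrow> x * y \<in> stabilizer_ring B"
  unfolding stabilizer_ring_def by (auto simp: mult.assoc)

lemma stabilizer_ring_of_int: "of_int c \<in> stabilizer_ring B"
  unfolding stabilizer_ring_def by (auto intro: int_span_scale)

lemma stabilizer_ring_ieval:
  "x \<in> stabilizer_ring B \<Longrightarrow> ieval q x \<in> stabilizer_ring B"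
proof (induction q)
  case 0
  show ?case using stabilizer_ring_of_int[of 0 B] by simp
next
  case (pCons c q)
  thus ?case
    by (auto simp: ieval_pCons intro: stabilizer_ring_add stabilizer_ring_mult stabilizer_ring_of_int)
qed

text \<open>Determinant trick: \<open>z\<close> acts on the generators through an integer matrix, so
  it is an eigenvalue of that matrix and a root of the monic integer characteristic polynomial. The
  nonzero generator \<open>b0\<close> makes the eigenvector nonzero.\<close>

lemma algebraic_int_stabilizer_ring:
  fixes z :: "'a::field_char_0"
  assumes "finite B" "b0 \<in> B" "b0 \<noteq> 0" and z: "z \<in> stabilizer_ring B"
  shows "algebraic_int z"
proof -
  define m where "m = card B"
  obtain f where f: "bij_betw f {0..<m} B"
    using ex_bij_betw_nat_finite[OF \<open>finite B\<close>] by (auto simp: m_def)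
  have "\<forall>i\<in>{0..<m}. \<exists>c :: 'a \<Rightarrow> int. z * f i = (\<Sum>b\<in>B. of_int (c b) * b)"
  proof
    fix i assume "i \<in> {0..<m}"
    hence "f i \<in> B" using f by (auto simp: bij_betw_def)
    hence "z * f i \<in> int_span B"
      using z int_span_base[OF \<open>finite B\<close>] by (auto simp: stabilizer_ring_def)
    thus "\<exists>c :: 'a \<Rightarrow> int. z * f i = (\<Sum>b\<in>B. of_int (c b) * b)"
      by (auto simp: int_span_def)
  qed
  then obtain c :: "nat \<Rightarrow> 'a \<Rightarrow> int" where
    c: "\<And>i. i < m \<Longrightarrow> z * f i = (\<Sum>b\<in>B. of_int (c i b) * b)"
    by (metis atLeastLessThan_iff zero_le)
  define A where "A = mat m m (\<lambda>(i, j). c i (f j))"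
  have A: "A \<in> carrier_mat m m" by (simp add: A_def)
  define A' :: "'a mat" where "A' = map_mat of_int A"
  have A': "A' \<in> carrier_mat m m" using A by (simp add: A'_def)
  define v where "v = vec m f"
  obtain i0 where i0: "i0 < m" "f i0 = b0"
    using f \<open>b0 \<in> B\<close> by (auto simp: bij_betw_def)
  have "v \<noteq> 0\<^sub>v m"
    using i0 \<open>b0 \<noteq> 0\<close> by (metis index_vec index_zero_vec(1) v_def)
  moreover have "A' *\<^sub>v v = z \<cdot>\<^sub>v v"
  proof (rule eq_vecI)
    fix i assume "i < dim_vec (z \<cdot>\<^sub>v v)"
    hence i: "i < m" by (simp add: v_def)
    have "vec_index (A' *\<^sub>v v) i = (\<Sum>j\<in>{0..<m}. of_int (c i (f j)) * f j)"
      using i by (simp add: A'_def A_def v_def scalar_prod_def)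
    also have "\<dots> = (\<Sum>b\<in>B. of_int (c i b) * b)"
      using f by (rule sum.reindex_bij_betw)
    finally show "vec_index (A' *\<^sub>v v) i = vec_index (z \<cdot>\<^sub>v v) i"
      using c[OF i] i by (simp add: v_def)
  qed (simp add: A'_def A_def v_def)
  ultimately have "eigenvalue A' z"
    unfolding eigenvalue_def eigenvector_def using A' by (intro exI[of _ v]) (auto simp: v_def)
  hence "poly (char_poly A') z = 0"
    using eigenvalue_root_char_poly[OF A'] by simp
  moreover have "char_poly A' = map_poly of_int (char_poly A)"
    unfolding A'_def using A by (rule of_int_hom.char_poly_hom)
  moreover have "lead_coeff (char_poly A) = 1"
    using degree_monic_char_poly[OF A] by (simp add: monic_degree_0)
  ultimately show ?thesis
    unfolding algebraic_int_altdef_ipoly by auto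
qed

text \<open>The products \<open>x ^ i * y ^ j\<close> with exponents below the degrees of monic
  relations for \<open>x\<close> and \<open>y\<close> span a module stable under both
  multiplications. The element \<open>1\<close> later serves as the nonzero generator.\<close>

lemma algebraic_int_common_stabilizer:
  fixes x y :: "'a::field_char_0"
  assumes "algebraic_int x" "algebraic_int y"
  obtains B where "finite B" "1 \<in> B" "x \<in> stabilizer_ring B" "y \<in> stabilizer_ring B"
proof -
  have monic_relation: "\<exists>d (c :: nat \<Rightarrow> int). d > 0 \<and> t ^ d = (\<Sum>l<d. of_int (c l) * t ^ l)"
    if t: "algebraic_int t" for t :: 'a
  proof -
    obtain h where h: "ieval h t = 0" "lead_coeff h = 1"
      using t unfolding algebraic_int_altdef_ipoly by blast
    \<comment> \<open>A monic constant is 1 and has no root. The positive degree is what puts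
      \<open>1\<close> into \<open>B\<close>.\<close>
    have "degree h \<noteq> 0"
    proof
      assume "degree h = 0"
      with h(2) have "h = 1" by (metis degree_eq_zeroE lead_coeff_pCons(2) one_pCons)
      with h(1) show False by (simp add: ieval_1)
    qed
    have "0 = (\<Sum>l\<le>degree h. of_int (Polynomial.coeff h l) * t ^ l)"
      using h(1) by (simp add: poly_altdef degree_map_poly coeff_map_poly)
    also have "\<dots> = t ^ degree h + (\<Sum>l<degree h. of_int (Polynomial.coeff h l) * t ^ l)"
      using h(2) by (simp add: lessThan_Suc_atMost[symmetric])
    finally have "t ^ degree h = (\<Sum>l<degree h. of_int (- Polynomial.coeff h l) * t ^ l)"
      by (simp add: sum_negf eq_neg_iff_add_eq_0)
    with \<open>degree h \<noteq> 0\<close> show ?thesis by (intro exI[of _ "degree h"] exI[of _ "\<lambda>l. - Polynomial.coeff h l"]) auto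
  qed
  obtain d c where d: "d > 0" "x ^ d = (\<Sum>l<d. of_int (c l) * x ^ l)"
    using monic_relation[OF assms(1)] by blast
  obtain d' c' where d': "d' > 0" "y ^ d' = (\<Sum>l<d'. of_int (c' l) * y ^ l)"
    using monic_relation[OF assms(2)] by blast
  define B where "B = (\<lambda>(i, j). x ^ i * y ^ j) ` ({..<d} \<times> {..<d'})"
  have fin: "finite B" by (simp add: B_def)
  have mem: "x ^ i * y ^ j \<in> int_span B" if "i < d" "j < d'" for i j
    using that fin by (intro int_span_base) (auto simp: B_def)
  have "x * b \<in> int_span B" if b: "b \<in> B" for b
  proof -
    obtain i j where ij: "i < d" "j < d'" "b = x ^ i * y ^ j" using b by (auto simp: B_def)
    show ?thesis
    proof (cases "Suc i < d")
      case True
      thus ?thesis using mem[of "Suc i" j] ij by (simp add: mult_ac)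
    next
      case False
      hence "d = Suc i" using ij by simp
      \<comment> \<open>The exponent has reached \<open>d\<close>, and the monic relation brings it
        back below \<open>d\<close>.\<close>
      hence "x * b = x ^ d * y ^ j" using ij by (simp add: mult_ac)
      also have "\<dots> = (\<Sum>l<d. of_int (c l) * (x ^ l * y ^ j))"
        by (simp add: d sum_distrib_left sum_distrib_right mult_ac)
      also have "\<dots> \<in> int_span B"
        using ij by (intro int_span_sum int_span_scale mem) auto
      finally show ?thesis .
    qed
  qed
  moreover have "y * b \<in> int_span B" if b: "b \<in> B" for b
  proof -
    obtain i j where ij: "i < d" "j < d'" "b = x ^ i * y ^ j" using b by (auto simp: B_def)
    show ?thesis
    proof (cases "Suc j < d'")
      case True
      thus ?thesis using mem[of i "Suc j"] ij by (simp add: mult_ac)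
    next
      case False
      hence "d' = Suc j" using ij by simp
      hence "y * b = y ^ d' * x ^ i" using ij by (simp add: mult_ac)
      also have "\<dots> = (\<Sum>l<d'. of_int (c' l) * (x ^ i * y ^ l))"
        by (simp add: d' sum_distrib_left sum_distrib_right mult_ac)
      also have "\<dots> \<in> int_span B"
        using ij by (intro int_span_sum int_span_scale mem) auto
      finally show ?thesis .
    qed
  qed
  moreover have "1 \<in> B"
    unfolding B_def using d(1) d'(1) by (intro image_eqI[of _ _ "(0, 0)"]) auto
  ultimately show ?thesis using fin by (intro that[of B] stabilizer_ringI)
qed

lemma algebraic_int_add:
  fixes x y :: "'a::field_char_0"
  assumes "algebraic_int x" "algebraic_int y"
  shows "algebraic_int (x + y)"
  using algebraic_int_common_stabilizer[OF assms] algebraic_int_stabilizer_ring stabilizer_ring_add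
  by (metis zero_neq_one)

lemma algebraic_int_ieval:
  fixes x :: "'a::field_char_0"
  assumes "algebraic_int x"
  shows "algebraic_int (ieval q x)"
  using algebraic_int_common_stabilizer[OF assms assms] algebraic_int_stabilizer_ring stabilizer_ring_ieval
  by (metis zero_neq_one)

section \<open>Divisibility of the index\<close>

text \<open>The cosets of \<open>B\<close> are sorted by their value under \<open>\<psi>\<close>, and translations identify the
  \<open>p\<close> classes with each other.\<close>

lemma prime_dvd_add_index:
  fixes A B :: "'a::ab_group_add set" and \<psi> :: "'a \<Rightarrow> int" and p :: nat
  assumes "prime p"
    and A_add: "\<And>x y. x \<in> A \<Longrightarrow> y \<in> A \<Longrightarrow> x + y \<in> A"
    and B: "B \<subseteq> A" "0 \<in> B"
    and \<psi>_add: "\<And>x y. x \<in> A \<Longrightarrow> y \<in> A \<Longrightarrow> [\<psi> (x + y) = \<psi> x + \<psi> y] (mod int p)"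
    and \<psi>_B: "\<And>x. x \<in> B \<Longrightarrow> [\<psi> x = 0] (mod int p)"
    and x: "x \<in> A" "\<not> [\<psi> x = 0] (mod int p)"
  shows "p dvd add_index A B"
proof (cases "finite ((\<lambda>x. x +o B) ` A)")
  case False
  \<comment> \<open>An infinite set of cosets has cardinality 0, which \<open>p\<close>
    divides.\<close>
  thus ?thesis by (simp add: add_index_def)
next
  case True
  define C where "C = (\<lambda>r. (\<lambda>y. y +o B) ` {y \<in> A. [\<psi> y = r] (mod int p)})"
  have p: "p > 0" using \<open>prime p\<close> prime_gt_0_nat by blast
  have zero: "0 \<in> A" using B by auto
  have \<psi>0: "[\<psi> 0 = 0] (mod int p)" using \<psi>_B B by auto
  have mult: "\<exists>y\<in>A. [\<psi> y = int i * \<psi> x] (mod int p)" for i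
  proof (induction i)
    case 0
    show ?case using zero \<psi>0 by auto
  next
    case (Suc i)
    then obtain y where y: "y \<in> A" "[\<psi> y = int i * \<psi> x] (mod int p)" by blast
    have "[\<psi> (y + x) = int i * \<psi> x + \<psi> x] (mod int p)"
      using \<psi>_add[OF y(1) x(1)] cong_add[OF y(2) cong_refl] cong_trans by blast
    thus ?case using A_add[OF y(1) x(1)] by (auto simp: algebra_simps)
  qed
  \<comment> \<open>The residue of \<open>x\<close> is invertible mod \<open>p\<close>, so its
    multiples reach every class. The multiplier is reduced to a natural number because
    \<open>A\<close> is only assumed closed under sums.\<close>
  have surj: "\<exists>y\<in>A. [\<psi> y = r] (mod int p)" for r
  proof -
    have "coprime (\<psi> x) (int p)"
      using x(2) \<open>prime p\<close> by (metis cong_0_iff coprime_commute prime_imp_coprime prime_int_nat_transfer prime_nat_int_transfer)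
    then obtain s where s: "[\<psi> x * s = 1] (mod int p)"
      using cong_solve_coprime_int by blast
    define i where "i = nat ((s * r) mod int p)"
    have "[int i * \<psi> x = (s * r) * \<psi> x] (mod int p)"
      using p unfolding i_def by (intro cong_scalar_right) (simp add: cong_def)
    also have "(s * r) * \<psi> x = \<psi> x * s * r" by simp
    also have "[\<psi> x * s * r = 1 * r] (mod int p)" by (rule cong_scalar_right[OF s])
    finally show ?thesis using mult[of i] cong_trans by fastforce
  qed
  have union: "(\<lambda>x. x +o B) ` A = (\<Union>r\<in>{0..<int p}. C r)"
  proof -
    have "\<exists>r\<in>{0..<int p}. y +o B \<in> C r" if "y \<in> A" for y
      using that p by (intro bexI[of _ "\<psi> y mod int p"]) (auto simp: C_def cong_def)
    thus ?thesis by (auto simp: C_def)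
  qed
  have fin: "finite (C r)" for r
    using True by (rule rev_finite_subset) (auto simp: C_def)
  \<comment> \<open>Two representatives of one coset differ by an element of \<open>B\<close>, where
    \<open>\<psi>\<close> vanishes mod \<open>p\<close>, so each coset has a single residue.\<close>
  have disj: "C r \<inter> C s = {}" if "r \<in> {0..<int p}" "s \<in> {0..<int p}" "r \<noteq> s" for r s
  proof (rule ccontr)
    assume "C r \<inter> C s \<noteq> {}"
    then obtain y z where yz: "y \<in> A" "z \<in> A" "[\<psi> y = r] (mod int p)" "[\<psi> z = s] (mod int p)"
      "y +o B = z +o B" by (auto simp: C_def)
    have "y \<in> z +o B" using yz(5) B(2) by (metis add.right_neutral set_plus_intro2)
    then obtain b where b: "b \<in> B" "y = z + b" by (auto simp: elt_set_plus_def)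
    have "[\<psi> y = \<psi> z + 0] (mod int p)"
      unfolding b(2) using \<psi>_add[OF yz(2), of b] B b(1) \<psi>_B[OF b(1)]
      by (meson cong_add cong_refl cong_trans subsetD)
    hence "[r = s] (mod int p)" using yz(3,4) by (simp add: cong_def)
    with that show False by (simp add: cong_def)
  qed
  have card_le: "card (C r) \<le> card (C s)" for r s
  proof -
    obtain y where y: "y \<in> A" "[\<psi> y = s - r] (mod int p)" using surj by blast
    have "inj_on (\<lambda>S. y +o S) (C r)"
    proof (rule inj_on_inverseI)
      fix S show "(- y) +o (y +o S) = S" by (simp add: set_plus_rearrange2)
    qed
    moreover have "(\<lambda>S. y +o S) ` C r \<subseteq> C s"
    proof
      fix S assume "S \<in> (\<lambda>S. y +o S) ` C r"
      then obtain z where z: "z \<in> A" "[\<psi> z = r] (mod int p)" "S = y +o (z +o B)"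
        by (auto simp: C_def)
      have "[\<psi> (y + z) = (s - r) + r] (mod int p)"
        using \<psi>_add[OF y(1) z(1)] cong_add[OF y(2) z(2)] cong_trans by blast
      thus "S \<in> C s" using z(3) A_add[OF y(1) z(1)] by (auto simp: C_def set_plus_rearrange2)
    qed
    ultimately show ?thesis using fin by (rule card_inj_on_le)
  qed
  have "add_index A B = (\<Sum>r\<in>{0..<int p}. card (C r))"
    unfolding add_index_def union using fin disj by (intro card_UN_disjoint) auto
  also have "\<dots> = (\<Sum>r\<in>{0..<int p}. card (C 0))"
    using card_le by (intro sum.cong) (auto intro: antisym)
  finally show ?thesis by simp
qed

section \<open>Totally ramified extensions of the p-adic integers\<close>

text \<open>The unspecified remainder \<open>h\<close> absorbs all terms of order two and higher, so
  no factorial is divided out and the expansion is valid over power series with integer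
  coefficients.\<close>

lemma poly_taylor_2:
  fixes G :: "'b::idom poly"
  obtains h where "poly G (x + y) = poly G x + y * poly (pderiv G) x + y\<^sup>2 * h"
proof -
  have "\<exists>h. poly G (x + y) = poly G x + y * poly (pderiv G) x + y\<^sup>2 * h"
  proof (induction G)
    case (pCons a G)
    then obtain h where h: "poly G (x + y) = poly G x + y * poly (pderiv G) x + y\<^sup>2 * h" by blast
    show ?case
      by (rule exI[of _ "poly (pderiv G) x + (x + y) * h"])
        (simp add: h pderiv_pCons algebra_simps power2_eq_square)
  qed simp
  thus ?thesis using that by blast
qed

lemma poly_nth_0_cong:
  fixes G :: "int fps poly"
  shows "fps_nth f 0 = fps_nth g 0 \<Longrightarrow> fps_nth (poly G f) 0 = fps_nth (poly G g) 0"
  by (induction G) auto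

text \<open>Coefficients of the quotient in a division of \<open>f\<close> by
  \<open>X^e - c p\<close> whose remainder has all coefficients in \<open>{0..<p}\<close>: the
  excess over a digit at position \<open>i\<close> is carried to position \<open>i + e\<close>. The
  sign \<open>- c\<close> is correct because \<open>c\<close> squares to 1. The guard
  \<open>e = 0\<close> keeps the recursion well-founded.\<close>

fun digit_carry :: "nat \<Rightarrow> nat \<Rightarrow> int \<Rightarrow> int fps \<Rightarrow> nat \<Rightarrow> int" where
  "digit_carry p e c f i =
     - c * ((fps_nth f i - (if e = 0 \<or> i < e then 0 else digit_carry p e c f (i - e))) div int p)"

declare digit_carry.simps [simp del]

text \<open>The quotient of \<open>\<int>[[X]]\<close> by \<open>X\<^sup>e - c p\<close> with \<open>c = \<plusminus>1\<close> is \<open>\<int>\<^sub>p[\<rho>]\<close> with \<open>\<rho>\<^sup>e = c p\<close>.\<close>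

locale ramified_ring =
  fixes p e :: nat and c :: int
  assumes prime_p: "prime p" and e_pos: "e > 0" and c_sq: "c * c = 1"
begin

definition modulus :: "int fps" where
  "modulus = fps_X ^ e - fps_const (c * int p)"

text \<open>The quotient ring is handled through representatives: this relation is equality in
  it.\<close>

definition eqv :: "int fps \<Rightarrow> int fps \<Rightarrow> bool" (infix "\<approx>" 50) where
  "f \<approx> g \<longleftrightarrow> modulus dvd f - g"

lemma eqv_refl [simp]: "f \<approx> f"
  by (simp add: eqv_def)

lemma eqv_sym: "f \<approx> g \<Longrightarrow> g \<approx> f"
  unfolding eqv_def by (metis dvd_minus_iff minus_diff_eq)

lemma eqv_trans [trans]: "f \<approx> g \<Longrightarrow> g \<approx> h \<Longrightarrow> f \<approx> h"
  unfolding eqv_def using dvd_add[of modulus "f - g" "g - h"] by simp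

lemma eqv_add: "f \<approx> g \<Longrightarrow> f' \<approx> g' \<Longrightarrow> f + f' \<approx> g + g'"
  unfolding eqv_def using dvd_add[of modulus "f - g" "f' - g'"] by (simp add: algebra_simps)

lemma eqv_diff: "f \<approx> g \<Longrightarrow> f' \<approx> g' \<Longrightarrow> f - f' \<approx> g - g'"
  unfolding eqv_def using dvd_diff[of modulus "f - g" "f' - g'"] by (simp add: algebra_simps)

lemma eqv_mult: "f \<approx> g \<Longrightarrow> f' \<approx> g' \<Longrightarrow> f * f' \<approx> g * g'"
proof -
  assume "f \<approx> g" "f' \<approx> g'"
  hence "modulus dvd (f - g) * f' + g * (f' - g')"
    unfolding eqv_def by (intro dvd_add dvd_mult dvd_mult2)
  thus ?thesis by (simp add: eqv_def algebra_simps)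
qed

lemma eqv_power: "f \<approx> g \<Longrightarrow> f ^ m \<approx> g ^ m"
  by (induction m) (auto intro: eqv_mult)

text \<open>The constant term of \<open>modulus\<close> is \<open>- c p\<close>, so the constant
  coefficient mod \<open>p\<close> depends only on the class. It is the residue map of the local
  ring, sending the uniformizer \<open>X\<close> to 0.\<close>

lemma eqv_nth_0:
  assumes "f \<approx> g"
  shows "[fps_nth f 0 = fps_nth g 0] (mod int p)"
proof -
  obtain h where h: "f - g = modulus * h" using assms by (auto simp: eqv_def dvd_def)
  have "fps_nth f 0 - fps_nth g 0 = fps_nth (f - g) 0" by simp
  also have "\<dots> = int p * (- c * fps_nth h 0)"
    unfolding h using e_pos by (simp add: modulus_def)
  finally show ?thesis by (simp add: cong_iff_dvd_diff)
qed

lemma eqv_prime: "fps_const (int p) \<approx> fps_const c * fps_X ^ e"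
proof -
  have "fps_const (int p) - fps_const c * fps_X ^ e = modulus * (- fps_const c)"
    using c_sq by (simp add: modulus_def algebra_simps fps_const_mult[symmetric] del: fps_const_mult)
  thus ?thesis by (simp add: eqv_def)
qed

text \<open>\<open>X\<close> is not a zero divisor in the quotient: in
  \<open>X h = modulus * u\<close> the constant terms force \<open>u\<close> to vanish at 0, so
  \<open>X\<close> can be split off \<open>u\<close> and cancelled.\<close>

lemma eqv_X_cancel:
  assumes "fps_X ^ j * f \<approx> fps_X ^ j * g"
  shows "f \<approx> g"
proof -
  have step: "modulus dvd h" if XhT: "modulus dvd fps_X * h" for h
  proof -
    obtain u where u: "fps_X * h = modulus * u" using XhT by (auto simp: dvd_def)
    have "0 = fps_nth (modulus * u) 0" unfolding u[symmetric] by simp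
    hence "fps_nth u 0 = 0"
      using e_pos c_sq prime_gt_0_nat[OF prime_p] by (auto simp: modulus_def)
    hence "u = fps_X * fps_shift 1 u"
      by (intro fps_ext) (auto simp: fps_X_mult_nth)
    hence "fps_X * h = fps_X * (modulus * fps_shift 1 u)" using u by (metis mult.left_commute)
    thus ?thesis by simp
  qed
  have "modulus dvd fps_X ^ j * (f - g)" using assms by (simp add: eqv_def algebra_simps)
  hence "modulus dvd f - g"
  proof (induction j)
    case (Suc j)
    have "modulus dvd fps_X * (fps_X ^ j * (f - g))"
      using Suc.prems by (simp only: power_Suc mult.assoc)
    thus ?case by (rule Suc.IH[OF step])
  qed simp
  thus ?thesis by (simp add: eqv_def)
qed

text \<open>Since \<open>p\<close> is equivalent to \<open>c X^e\<close>, a constant term divisible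
  by \<open>p\<close> is itself a multiple of \<open>X\<close>. Thus \<open>X\<close> generates the
  kernel of the residue map.\<close>

lemma eqv_X_factor:
  assumes "int p dvd fps_nth f 0"
  obtains g where "f \<approx> fps_X * g"
proof -
  obtain t where t: "fps_nth f 0 = int p * t" using assms by (auto simp: dvd_def)
  have "f = fps_const t * fps_const (int p) + fps_X * fps_shift 1 f"
    using t by (intro fps_ext) (auto simp: fps_X_mult_nth)
  also have "\<dots> \<approx> fps_const t * (fps_const c * fps_X ^ e) + fps_X * fps_shift 1 f"
    by (intro eqv_add eqv_mult eqv_prime eqv_refl)
  also have "\<dots> = fps_X * (fps_const t * fps_const c * fps_X ^ (e - 1) + fps_shift 1 f)"
    using e_pos by (cases e) (auto simp: algebra_simps)
  finally show ?thesis by (rule that)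
qed

text \<open>Division by \<open>modulus\<close> leaves a remainder with digits between 0 and
  \<open>p - 1\<close>. Its lowest nonzero digit is prime to \<open>p\<close>, which exhibits a
  nonzero element as a power of the uniformizer times an element of nonzero residue.\<close>

lemma eqv_normal_form:
  obtains "f \<approx> 0" | j w where "f \<approx> fps_X ^ j * w" "\<not> int p dvd fps_nth w 0"
proof -
  \<comment> \<open>\<open>g\<close> is the quotient and \<open>d\<close> the remainder of this
    division.\<close>
  define g where "g = Abs_fps (digit_carry p e c f)"
  define d where "d = Abs_fps (\<lambda>i. (fps_nth f i - (if i < e then 0 else fps_nth g (i - e))) mod int p)"
  have "fps_nth (f - d) i = fps_nth (modulus * g) i" for i
  proof -
    define s where "s = fps_nth f i - (if i < e then 0 else fps_nth g (i - e))"
    have "fps_nth g i = - c * (s div int p)"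
      using e_pos by (simp add: g_def s_def digit_carry.simps[of p e c f i])
    hence "c * int p * fps_nth g i = - ((c * c) * (int p * (s div int p)))"
      by (simp add: algebra_simps)
    hence cp: "c * int p * fps_nth g i = - (int p * (s div int p))" by (simp only: c_sq)
    have "fps_nth (modulus * g) i = (if i < e then 0 else fps_nth g (i - e)) - c * int p * fps_nth g i"
      by (simp add: modulus_def left_diff_distrib fps_X_power_mult_nth)
    also have "\<dots> = (if i < e then 0 else fps_nth g (i - e)) + int p * (s div int p)"
      using cp by linarith
    also have "\<dots> = fps_nth f i - s + (s - s mod int p)"
      by (simp add: s_def minus_mod_eq_mult_div)
    also have "\<dots> = fps_nth (f - d) i" by (simp add: d_def s_def)
    finally show ?thesis by simp
  qed
  hence "f - d = modulus * g" by (intro fps_ext) simp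
  hence fd: "f \<approx> d" by (simp add: eqv_def)
  show ?thesis
  proof (cases "d = 0")
    case True
    thus ?thesis using fd that(1) by simp
  next
    case False
    define j where "j = subdegree d"
    have d: "d = fps_X ^ j * fps_shift j d"
      by (metis fps_shift_times_fps_X_power' j_def le_refl fps_mult_fps_X_power_commute subdegree_decompose)
    have "fps_nth d j \<noteq> 0" using False by (simp add: j_def)
    moreover have "0 \<le> fps_nth d j" "fps_nth d j < int p"
      using prime_gt_0_nat[OF prime_p] by (simp_all add: d_def)
    ultimately have "\<not> int p dvd fps_nth d j" using zdvd_not_zless by fastforce
    hence "\<not> int p dvd fps_nth (fps_shift j d) 0" by simp
    thus ?thesis using that(2) fd d by metis
  qed
qed

lemma not_eqv_0:
  assumes "f \<approx> fps_X ^ j * w" "\<not> int p dvd fps_nth w 0"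
  shows "\<not> f \<approx> 0"
proof
  assume "f \<approx> 0"
  hence "fps_X ^ j * w \<approx> fps_X ^ j * 0" using eqv_trans[OF eqv_sym[OF assms(1)]] by simp
  hence "w \<approx> 0" by (rule eqv_X_cancel)
  from eqv_nth_0[OF this] assms(2) show False by (simp add: cong_0_iff)
qed

text \<open>The quotient is a domain: exponents of \<open>X\<close> add, and nonzero residues
  multiply to a nonzero residue because \<open>p\<close> is prime.\<close>

lemma eqv_0_mult:
  assumes "f * g \<approx> 0"
  shows "f \<approx> 0 \<or> g \<approx> 0"
proof (rule eqv_normal_form[of f]; rule eqv_normal_form[of g])
  fix j w i u
  assume f: "f \<approx> fps_X ^ j * w" "\<not> int p dvd fps_nth w 0"
    and g: "g \<approx> fps_X ^ i * u" "\<not> int p dvd fps_nth u 0"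
  have "f * g \<approx> fps_X ^ (j + i) * (w * u)"
    using eqv_mult[OF f(1) g(1)] by (simp add: power_add mult_ac)
  moreover have "\<not> int p dvd fps_nth (w * u) 0"
    using f(2) g(2) prime_p by (simp add: prime_dvd_mult_iff)
  ultimately show ?thesis using not_eqv_0 assms by blast
qed auto

text \<open>The quotient has characteristic 0: the \<open>p\<close>-part of a nonzero integer turns
  into a power of \<open>X\<close>, and the cofactor keeps a nonzero residue.\<close>

lemma eqv_const_0:
  assumes "fps_const m \<approx> 0"
  shows "m = 0"
proof (rule ccontr)
  assume "m \<noteq> 0"
  moreover have "\<not> is_unit (int p)" using not_prime_unit[of "int p"] prime_p by auto
  ultimately obtain m' where m': "m = int p ^ multiplicity (int p) m * m'" "\<not> int p dvd m'"
    by (rule multiplicity_decompose')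
  define i where "i = multiplicity (int p) m"
  have "fps_const m = fps_const (int p) ^ i * fps_const m'"
    unfolding fps_const_power fps_const_mult using m'(1) by (simp add: i_def)
  also have "\<dots> \<approx> (fps_const c * fps_X ^ e) ^ i * fps_const m'"
    by (intro eqv_mult eqv_power eqv_prime eqv_refl)
  also have "\<dots> = fps_X ^ (e * i) * fps_const (c ^ i * m')"
    by (simp only: power_mult_distrib power_mult fps_const_power[symmetric] fps_const_mult[symmetric] mult_ac)
  finally have "fps_const m \<approx> fps_X ^ (e * i) * fps_const (c ^ i * m')" .
  moreover have "\<not> int p dvd c ^ i * m'"
  proof
    assume "int p dvd c ^ i * m'"
    hence "int p dvd c ^ i * (c ^ i * m')" by (rule dvd_mult)
    also have "c ^ i * (c ^ i * m') = (c * c) ^ i * m'" by (simp add: power_mult_distrib)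
    finally show False using m'(2) by (simp add: c_sq)
  qed
  ultimately show False using not_eqv_0 assms by simp
qed

text \<open>Newton approximation, one power of \<open>X\<close> at a time. Each correction changes a
  single new coefficient, so the approximations converge coefficientwise to a power series.\<close>

lemma hensel:
  fixes G :: "int fps poly"
  assumes root: "int p dvd fps_nth (poly G u0) 0"
    and simple: "\<not> int p dvd fps_nth (poly (pderiv G) u0) 0"
  obtains u where "poly G u \<approx> 0" "fps_nth u 0 = fps_nth u0 0"
proof -
  define Q where "Q = (\<lambda>j u. fps_nth u 0 = fps_nth u0 0 \<and> (\<exists>w. poly G u \<approx> fps_X ^ Suc j * w))"
  have "\<exists>U. \<forall>j. Q j (U j) \<and> (\<exists>t. U (Suc j) = U j + fps_X ^ Suc j * fps_const t)"
  proof (rule dependent_nat_choice)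
    obtain w where "poly G u0 \<approx> fps_X * w" using root by (rule eqv_X_factor)
    thus "\<exists>u. Q 0 u" by (auto simp: Q_def)
  next
    fix u j assume "Q j u"
    then obtain w where u: "fps_nth u 0 = fps_nth u0 0" and w: "poly G u \<approx> fps_X ^ Suc j * w"
      by (auto simp: Q_def)
    define D where "D = fps_nth (poly (pderiv G) u) 0"
    have "\<not> int p dvd D" using simple poly_nth_0_cong[OF u] by (simp add: D_def)
    hence "coprime D (int p)"
      using prime_p by (metis coprime_commute prime_imp_coprime prime_nat_int_transfer)
    then obtain s where s: "[D * s = 1] (mod int p)" using cong_solve_coprime_int by blast
    \<comment> \<open>This digit makes \<open>fps_nth w 0 + t * D\<close> vanish mod
      \<open>p\<close>, since \<open>s\<close> inverts \<open>D\<close>.\<close>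
    define t where "t = - (s * fps_nth w 0)"
    obtain h where h: "poly G (u + fps_X ^ Suc j * fps_const t) = poly G u
        + fps_X ^ Suc j * fps_const t * poly (pderiv G) u + (fps_X ^ Suc j * fps_const t)\<^sup>2 * h"
      by (rule poly_taylor_2)
    define v where "v = w + fps_const t * poly (pderiv G) u + fps_X ^ Suc j * fps_const t ^ 2 * h"
    have "poly G (u + fps_X ^ Suc j * fps_const t) \<approx> fps_X ^ Suc j * w
        + fps_X ^ Suc j * fps_const t * poly (pderiv G) u + (fps_X ^ Suc j * fps_const t)\<^sup>2 * h"
      unfolding h by (intro eqv_add w eqv_refl)
    also have "\<dots> = fps_X ^ Suc j * v"
      by (simp add: v_def algebra_simps power2_eq_square)
    finally have *: "poly G (u + fps_X ^ Suc j * fps_const t) \<approx> fps_X ^ Suc j * v" .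
    have "fps_nth v 0 = fps_nth w 0 + t * D"
      by (simp add: v_def D_def)
    also have "\<dots> = fps_nth w 0 * (1 - D * s)" by (simp add: t_def algebra_simps)
    also have "int p dvd \<dots>"
      using s by (intro dvd_mult) (metis cong_iff_dvd_diff cong_sym)
    finally obtain v' where "v \<approx> fps_X * v'" by (rule eqv_X_factor)
    hence "fps_X ^ Suc j * v \<approx> fps_X ^ Suc j * (fps_X * v')" by (intro eqv_mult eqv_refl)
    from eqv_trans[OF * this]
    have "poly G (u + fps_X ^ Suc j * fps_const t) \<approx> fps_X ^ Suc (Suc j) * v'"
      by (simp add: mult_ac)
    moreover have "fps_nth (u + fps_X ^ Suc j * fps_const t) 0 = fps_nth u0 0"
      using u by (simp add: fps_X_power_mult_nth del: power_Suc)
    ultimately have "Q (Suc j) (u + fps_X ^ Suc j * fps_const t)" by (auto simp: Q_def)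
    thus "\<exists>y. Q (Suc j) y \<and> (\<exists>t. y = u + fps_X ^ Suc j * fps_const t)" by blast
  qed
  then obtain U where Q: "\<And>j. Q j (U j)"
    and U: "\<And>j. \<exists>t. U (Suc j) = U j + fps_X ^ Suc j * fps_const t" by blast
  have stable: "fps_nth (U (i + d)) i = fps_nth (U i) i" for i d
  proof (induction d)
    case (Suc d)
    obtain t where t: "U (Suc (i + d)) = U (i + d) + fps_X ^ Suc (i + d) * fps_const t"
      using U by blast
    show ?case using Suc by (simp add: t fps_X_power_mult_nth del: power_Suc)
  qed simp
  \<comment> \<open>Coefficient \<open>i\<close> no longer changes after stage \<open>i\<close>, so
    the diagonal is the limit.\<close>
  define u where "u = Abs_fps (\<lambda>i. fps_nth (U i) i)"
  have tail: "u = U j + fps_X ^ Suc j * fps_shift (Suc j) (u - U j)" for j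
  proof (rule fps_ext)
    fix i
    show "fps_nth u i = fps_nth (U j + fps_X ^ Suc j * fps_shift (Suc j) (u - U j)) i"
      using stable[of i "j - i"]
      by (cases "i \<le> j") (simp_all add: u_def fps_X_power_mult_nth del: power_Suc)
  qed
  have high: "\<exists>w. poly G u \<approx> fps_X ^ Suc j * w" for j
  proof -
    obtain w where w: "poly G (U j) \<approx> fps_X ^ Suc j * w" using Q[of j] by (auto simp: Q_def)
    define v where "v = fps_shift (Suc j) (u - U j)"
    obtain h where h: "poly G (U j + fps_X ^ Suc j * v) = poly G (U j)
        + fps_X ^ Suc j * v * poly (pderiv G) (U j) + (fps_X ^ Suc j * v)\<^sup>2 * h"
      by (rule poly_taylor_2)
    have "poly G u = poly G (U j + fps_X ^ Suc j * v)" unfolding v_def using tail[of j] by simp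
    also have "\<dots> \<approx> fps_X ^ Suc j * w
        + fps_X ^ Suc j * v * poly (pderiv G) (U j) + (fps_X ^ Suc j * v)\<^sup>2 * h"
      unfolding h by (intro eqv_add w eqv_refl)
    also have "\<dots> = fps_X ^ Suc j * (w + v * poly (pderiv G) (U j) + fps_X ^ Suc j * v\<^sup>2 * h)"
      by (simp add: algebra_simps power2_eq_square)
    finally show ?thesis by blast
  qed
  \<comment> \<open>A nonzero value would contain an exact power \<open>X^j\<close>, contradicting
    divisibility by \<open>X^(j+1)\<close>.\<close>
  have "poly G u \<approx> 0"
  proof (rule eqv_normal_form[of "poly G u"])
    fix j w assume w: "poly G u \<approx> fps_X ^ j * w" "\<not> int p dvd fps_nth w 0"
    obtain w' where w': "poly G u \<approx> fps_X ^ Suc j * w'" using high by blast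
    have "fps_X ^ j * w \<approx> fps_X ^ j * (fps_X * w')"
      using eqv_trans[OF eqv_sym[OF w(1)] w'] by (simp add: mult_ac)
    hence "w \<approx> fps_X * w'" by (rule eqv_X_cancel)
    from eqv_nth_0[OF this] have "int p dvd fps_nth w 0" by (simp add: cong_0_iff)
    with w(2) show ?thesis by simp
  qed
  moreover have "fps_nth u 0 = fps_nth u0 0" using Q[of 0] by (simp add: u_def Q_def)
  ultimately show ?thesis by (rule that)
qed

end

section \<open>Places with residue field of order p\<close>

lemma of_int_fps: "of_int m = (fps_const m :: int fps)"
  by (metis fps_of_int of_int_eq_id id_apply)

text \<open>\<open>P x v\<close> says that \<open>x\<close> is finite at the place and has residue \<open>v mod p\<close>.\<close>

definition residue_place :: "nat \<Rightarrow> 'a::field_char_0 set \<Rightarrow> ('a \<Rightarrow> int \<Rightarrow> bool) \<Rightarrow> bool" where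
  "residue_place p A P \<longleftrightarrow>
     (\<forall>x v v'. P x v \<longrightarrow> P x v' \<longrightarrow> [v = v'] (mod int p)) \<and>
     (\<forall>m. P (of_int m) m) \<and>
     (\<forall>x v y w. P x v \<longrightarrow> P y w \<longrightarrow> P (x + y) (v + w) \<and> P (x * y) (v * w)) \<and>
     (\<forall>x\<in>A. \<exists>v. P x v)"

lemma residue_placeD:
  assumes "residue_place p A P"
  shows "P x v \<Longrightarrow> P x v' \<Longrightarrow> [v = v'] (mod int p)" and "P (of_int m) m"
    and "P x v \<Longrightarrow> P y w \<Longrightarrow> P (x + y) (v + w)" and "P x v \<Longrightarrow> P y w \<Longrightarrow> P (x * y) (v * w)"
    and "x \<in> A \<Longrightarrow> \<exists>v. P x v"
  using assms unfolding residue_place_def by blast+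

lemma ieval_closed:
  assumes "\<And>m. P (of_int m) m"
    and "\<And>x v y w. P x v \<Longrightarrow> P y w \<Longrightarrow> P (x + y) (v + w)"
    and "\<And>x v y w. P x v \<Longrightarrow> P y w \<Longrightarrow> P (x * y) (v * w)"
    and "P x v"
  shows "P (ieval q x) (poly q v)"
proof (induction q)
  case 0
  show ?case using assms(1)[of 0] by simp
next
  case (pCons a q)
  thus ?case using assms by (simp add: ieval_pCons)
qed

section \<open>Bezout relations over the integers and fractions in \<alpha>\<close>

lemma clear_denominators:
  fixes q :: "rat poly"
  obtains d k where "d \<noteq> 0" "Polynomial.smult (of_int d) q = map_poly rat_of_int k"
proof -
  have "\<exists>d k. d \<noteq> 0 \<and> Polynomial.smult (of_int d) q = map_poly rat_of_int k"
  proof (induction q)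
    case 0
    show ?case by (rule exI[of _ 1], rule exI[of _ 0]) simp
  next
    case (pCons a q)
    then obtain d k where d: "d \<noteq> 0" "Polynomial.smult (of_int d) q = map_poly rat_of_int k" by blast
    obtain n m where nm: "m > 0" "a = of_int n / of_int m"
      by (metis quotient_of_denom_pos quotient_of_div surj_pair)
    have "Polynomial.smult (of_int (m * d)) (pCons a q)
        = pCons (of_int (n * d)) (Polynomial.smult (of_int m) (Polynomial.smult (of_int d) q))"
      using nm by simp
    also have "\<dots> = map_poly rat_of_int (pCons (n * d) (Polynomial.smult m k))"
      unfolding d(2) by (simp add: hom_distribs)
    finally show ?case using d(1) nm(1) by (intro exI[of _ "m * d"] exI) auto
  qed
  thus ?thesis using that by blast
qed

text \<open>Irreducibility makes \<open>F\<close> and \<open>s\<close> coprime over the rationals,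
  and clearing denominators in a Bezout identity leaves a nonzero integer. In this form the identity
  can be evaluated both at \<alpha> and in the local ring.\<close>

lemma irreducible_int_bezout:
  fixes F s :: "int poly"
  assumes "irreducible (map_poly rat_of_int F)" "\<not> map_poly rat_of_int F dvd map_poly rat_of_int s"
  obtains A B m where "m \<noteq> 0" "A * F + B * s = [:m:]"
proof -
  have "coprime (map_poly rat_of_int F) (map_poly rat_of_int s)"
    using irreducible_imp_prime_elem_gcd[OF assms(1)] assms(2) by (rule prime_elem_imp_coprime)
  then obtain a b where ab: "a * map_poly rat_of_int F + b * map_poly rat_of_int s = 1"
    by (metis bezout_coefficients_fst_snd coprime_iff_gcd_eq_1)
  obtain d A where d: "d \<noteq> 0" "Polynomial.smult (of_int d) a = map_poly rat_of_int A"
    by (rule clear_denominators)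
  obtain d' B where d': "d' \<noteq> 0" "Polynomial.smult (of_int d') b = map_poly rat_of_int B"
    by (rule clear_denominators)
  have "map_poly rat_of_int (Polynomial.smult d' A * F + Polynomial.smult d B * s)
      = Polynomial.smult (of_int d') (Polynomial.smult (of_int d) a) * map_poly rat_of_int F
      + Polynomial.smult (of_int d) (Polynomial.smult (of_int d') b) * map_poly rat_of_int s"
    unfolding d(2) d'(2) by (simp add: hom_distribs)
  also have "\<dots> = Polynomial.smult (of_int (d * d')) (a * map_poly rat_of_int F + b * map_poly rat_of_int s)"
    by (simp add: smult_add_right mult.commute)
  also have "\<dots> = map_poly rat_of_int [:d * d':]" unfolding ab by (simp add: hom_distribs)
  finally have "Polynomial.smult d' A * F + Polynomial.smult d B * s = [:d * d':]"
    by (simp only: of_int_poly_hom.eq_iff)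
  moreover have "d * d' \<noteq> 0" using d(1) d'(1) by simp
  ultimately show ?thesis by (intro that)
qed

text \<open>For nonzero \<open>r\<close> of smaller degree, the Bezout identity evaluated at
  \<alpha> would equate 0 with a nonzero integer.\<close>

lemma irreducible_root_degree:
  fixes F r :: "int poly" and \<alpha> :: "'a::field_char_0"
  assumes irred: "irreducible (map_poly rat_of_int F)" and F: "ieval F \<alpha> = 0"
    and r: "ieval r \<alpha> = 0" "degree r < degree F"
  shows "r = 0"
proof (rule ccontr)
  assume "r \<noteq> 0"
  hence "\<not> map_poly rat_of_int F dvd map_poly rat_of_int r"
    using r(2) by (auto dest!: dvd_imp_degree_le)
  with irred obtain A B m where m: "m \<noteq> 0" "A * F + B * r = [:m:]" by (rule irreducible_int_bezout)
  have "ieval (A * F + B * r) \<alpha> = 0" using F r(1) by (simp only: ieval_simps mult_zero_right add_0_right)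
  thus False using m by simp
qed

lemma not_dvd_of_root_nonroot:
  fixes F s :: "int poly" and \<alpha> :: "'a::field_char_0"
  assumes F: "ieval F \<alpha> = 0" and s: "ieval s \<alpha> \<noteq> 0"
  shows "\<not> map_poly rat_of_int F dvd map_poly rat_of_int s"
proof
  assume "map_poly rat_of_int F dvd map_poly rat_of_int s"
  then obtain q where q: "map_poly rat_of_int s = map_poly rat_of_int F * q" by (auto simp: dvd_def)
  obtain d k where d: "d \<noteq> 0" "Polynomial.smult (of_int d) q = map_poly rat_of_int k"
    by (rule clear_denominators)
  have "map_poly rat_of_int (Polynomial.smult d s) = map_poly rat_of_int (F * k)"
    using q d(2)[symmetric] by (simp add: hom_distribs)
  hence "Polynomial.smult d s = F * k" by (simp only: of_int_poly_hom.eq_iff)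
  hence "ieval (Polynomial.smult d s) \<alpha> = ieval (F * k) \<alpha>" by simp
  hence "of_int d * ieval s \<alpha> = 0" using F by (simp only: ieval_simps mult_zero_left)
  thus False using d(1) s by simp
qed

text \<open>The fractions of this shape form a subfield containing \<alpha>, and the hull is
  contained in every such subfield.\<close>

lemma rat_adjoin_fraction:
  fixes \<alpha> :: "'a::field_char_0"
  assumes "x \<in> rat_adjoin \<alpha>"
  obtains q r where "ieval r \<alpha> \<noteq> 0" "x = ieval q \<alpha> / ieval r \<alpha>"
proof -
  define L where "L = {x. \<exists>q r. ieval r \<alpha> \<noteq> 0 \<and> x = ieval q \<alpha> / ieval r \<alpha>}"
  have memI: "x \<in> L" if "ieval r \<alpha> \<noteq> 0" "x = ieval q \<alpha> / ieval r \<alpha>" for x q r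
    using that unfolding L_def by blast
  have "0 \<in> L" by (rule memI[of 1 _ 0]) (simp_all add: ieval_1)
  moreover have "1 \<in> L" by (rule memI[of 1 _ 1]) (simp_all add: ieval_1)
  moreover have "\<alpha> \<in> L" by (rule memI[of 1 _ "[:0, 1:]"]) (simp_all add: ieval_simps)
  moreover have "x + y \<in> L \<and> x * y \<in> L" if "x \<in> L" "y \<in> L" for x y
  proof -
    obtain q r s t where *: "ieval r \<alpha> \<noteq> 0" "x = ieval q \<alpha> / ieval r \<alpha>"
        "ieval t \<alpha> \<noteq> 0" "y = ieval s \<alpha> / ieval t \<alpha>"
      using \<open>x \<in> L\<close> \<open>y \<in> L\<close> unfolding L_def by blast
    show ?thesis
      using * memI[of "r * t" "x + y" "q * t + s * r"] memI[of "r * t" "x * y" "q * s"]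
      by (simp add: ieval_simps add_frac_eq)
  qed
  moreover have "- x \<in> L \<and> inverse x \<in> L" if "x \<in> L" for x
  proof -
    obtain q r where *: "ieval r \<alpha> \<noteq> 0" "x = ieval q \<alpha> / ieval r \<alpha>"
      using \<open>x \<in> L\<close> unfolding L_def by blast
    have "inverse x \<in> L"
    proof (cases "ieval q \<alpha> = 0")
      case True
      thus ?thesis using * \<open>0 \<in> L\<close> by simp
    next
      case False
      thus ?thesis using * memI[of q "inverse x" r] by simp
    qed
    thus ?thesis using * memI[of r "- x" "- q"] by (simp add: ieval_simps)
  qed
  ultimately have "is_subfield L" "{\<alpha>} \<subseteq> L" by (auto simp: is_subfield_def)
  hence "rat_adjoin \<alpha> \<subseteq> L" unfolding rat_adjoin_def by (simp add: hull_minimal)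
  thus ?thesis using assms that unfolding L_def by blast
qed

section \<open>The place attached to a root of F in a local ring\<close>

locale local_root = ramified_ring +
  fixes F :: "int poly" and \<alpha> :: "'a::field_char_0" and \<beta> :: "int fps"
  assumes irred: "irreducible (map_poly rat_of_int F)"
    and root: "ieval F \<alpha> = 0" and local_root: "ieval F \<beta> \<approx> 0"
begin

text \<open>This makes the substitution of \<beta> for \<alpha> well defined. Pseudo-division by
  \<open>F\<close> stays over the integers; the remainder vanishes at \<alpha> and has too small a
  degree, so it is 0, and the nonzero multiplier \<open>a\<close> cancels in a domain of
  characteristic 0.\<close>

lemma eval_transfer:
  assumes "ieval q \<alpha> = 0"
  shows "ieval q \<beta> \<approx> 0"
proof -
  have "F \<noteq> 0" using irred by auto
  define r where "r = pseudo_mod q F"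
  obtain a s where a: "a \<noteq> 0" "Polynomial.smult a q = F * s + r"
    using pseudo_mod(1)[OF \<open>F \<noteq> 0\<close>, of q] by (auto simp: r_def)
  have "of_int a * ieval q \<alpha> = ieval F \<alpha> * ieval s \<alpha> + ieval r \<alpha>"
    using arg_cong[OF a(2), of "\<lambda>q. ieval q \<alpha>"] by (simp only: ieval_simps)
  hence r0: "ieval r \<alpha> = 0" using assms root by simp
  have "r = 0"
    using pseudo_mod(2)[OF \<open>F \<noteq> 0\<close>, of q] irreducible_root_degree[OF irred root r0]
    by (auto simp: r_def)
  hence "of_int a * ieval q \<beta> = ieval F \<beta> * ieval s \<beta>"
    using arg_cong[OF a(2), of "\<lambda>q. ieval q \<beta>"] by (simp only: ieval_simps add_0_right)
  also have "\<dots> \<approx> 0 * ieval s \<beta>" by (intro eqv_mult local_root eqv_refl)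
  finally have "of_int a * ieval q \<beta> \<approx> 0" by simp
  thus ?thesis
    using eqv_0_mult eqv_const_0[of a] a(1) by (auto simp: of_int_fps)
qed

text \<open>The residue of \<open>q(\<beta>) / r(\<beta>)\<close>. A common power of
  \<open>X\<close> is split off so that the remaining denominator has nonzero residue; the remaining
  numerator may still be divisible by \<open>X\<close>. A relation is used because not every element
  is finite at the place.\<close>

definition place :: "'a \<Rightarrow> int \<Rightarrow> bool" where
  "place x v \<longleftrightarrow> (\<exists>q r j w w'. ieval r \<alpha> \<noteq> 0 \<and> x = ieval q \<alpha> / ieval r \<alpha> \<and>
     ieval q \<beta> \<approx> fps_X ^ j * w \<and> ieval r \<beta> \<approx> fps_X ^ j * w' \<and>
     \<not> int p dvd fps_nth w' 0 \<and> [v * fps_nth w' 0 = fps_nth w 0] (mod int p))"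

lemma placeI:
  assumes "ieval r \<alpha> \<noteq> 0" "x = ieval q \<alpha> / ieval r \<alpha>"
    "ieval q \<beta> \<approx> fps_X ^ j * w" "ieval r \<beta> \<approx> fps_X ^ j * w'"
    "\<not> int p dvd fps_nth w' 0" "[v * fps_nth w' 0 = fps_nth w 0] (mod int p)"
  shows "place x v"
  using assms unfolding place_def by blast

lemma place_ieval: "place (ieval q \<alpha>) (fps_nth (ieval q \<beta>) 0)"
  using not_prime_unit[of "int p"] prime_p
  by (intro placeI[of 1 _ q 0 "ieval q \<beta>" 1]) (auto simp: ieval_1)

lemma place_of_int: "place (of_int m) m"
  using place_ieval[of "[:m:]"] by (simp add: ieval_pCons of_int_fps)

text \<open>Two fractions for \<open>x\<close> have equal cross products at \<alpha>, hence at
  \<beta> by \<open>eval_transfer\<close>. After cancelling the power of \<open>X\<close>, the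
  residues agree up to factors invertible mod \<open>p\<close>.\<close>

lemma place_unique:
  assumes "place x v" "place x v'"
  shows "[v = v'] (mod int p)"
proof -
  obtain q r j w u where 1: "ieval r \<alpha> \<noteq> 0" "x = ieval q \<alpha> / ieval r \<alpha>"
    "ieval q \<beta> \<approx> fps_X ^ j * w" "ieval r \<beta> \<approx> fps_X ^ j * u"
    "\<not> int p dvd fps_nth u 0" "[v * fps_nth u 0 = fps_nth w 0] (mod int p)"
    using assms(1) unfolding place_def by blast
  obtain q' r' j' w' u' where 2: "ieval r' \<alpha> \<noteq> 0" "x = ieval q' \<alpha> / ieval r' \<alpha>"
    "ieval q' \<beta> \<approx> fps_X ^ j' * w'" "ieval r' \<beta> \<approx> fps_X ^ j' * u'"
    "\<not> int p dvd fps_nth u' 0" "[v' * fps_nth u' 0 = fps_nth w' 0] (mod int p)"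
    using assms(2) unfolding place_def by blast
  have "ieval (q * r' - q' * r) \<alpha> = 0"
    using 1(1,2) 2(1,2) by (simp add: ieval_simps frac_eq_eq)
  hence 3: "ieval (q * r' - q' * r) \<beta> \<approx> 0" by (rule eval_transfer)
  have "ieval (q * r' - q' * r) \<beta>
      \<approx> (fps_X ^ j * w) * (fps_X ^ j' * u') - (fps_X ^ j' * w') * (fps_X ^ j * u)"
    unfolding ieval_simps by (intro eqv_diff eqv_mult 1 2)
  from eqv_trans[OF eqv_sym[OF this] 3]
  have "fps_X ^ (j + j') * (w * u' - w' * u) \<approx> fps_X ^ (j + j') * 0"
    by (simp add: algebra_simps power_add)
  hence "w * u' - w' * u \<approx> 0" by (rule eqv_X_cancel)
  from eqv_nth_0[OF this] have "[fps_nth w 0 * fps_nth u' 0 = fps_nth w' 0 * fps_nth u 0] (mod int p)"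
    by (simp add: cong_iff_dvd_diff)
  moreover have "[v * fps_nth u 0 * fps_nth u' 0 = fps_nth w 0 * fps_nth u' 0] (mod int p)"
    by (rule cong_scalar_right[OF 1(6)])
  moreover have "[v' * fps_nth u' 0 * fps_nth u 0 = fps_nth w' 0 * fps_nth u 0] (mod int p)"
    by (rule cong_scalar_right[OF 2(6)])
  ultimately have "[v * (fps_nth u 0 * fps_nth u' 0) = v' * (fps_nth u 0 * fps_nth u' 0)] (mod int p)"
    by (simp add: cong_def mult_ac)
  moreover have "\<not> int p dvd fps_nth u 0 * fps_nth u' 0"
    using 1(5) 2(5) prime_p by (simp add: prime_dvd_mult_iff)
  hence "coprime (fps_nth u 0 * fps_nth u' 0) (int p)"
    using prime_p by (metis coprime_commute prime_imp_coprime prime_nat_int_transfer)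
  ultimately show ?thesis by (simp add: cong_mult_rcancel)
qed

lemma place_add_mult:
  assumes "place x v" "place y v'"
  shows "place (x + y) (v + v')" "place (x * y) (v * v')"
proof -
  obtain q r j w u where 1: "ieval r \<alpha> \<noteq> 0" "x = ieval q \<alpha> / ieval r \<alpha>"
    "ieval q \<beta> \<approx> fps_X ^ j * w" "ieval r \<beta> \<approx> fps_X ^ j * u"
    "\<not> int p dvd fps_nth u 0" "[v * fps_nth u 0 = fps_nth w 0] (mod int p)"
    using assms(1) unfolding place_def by blast
  obtain q' r' j' w' u' where 2: "ieval r' \<alpha> \<noteq> 0" "y = ieval q' \<alpha> / ieval r' \<alpha>"
    "ieval q' \<beta> \<approx> fps_X ^ j' * w'" "ieval r' \<beta> \<approx> fps_X ^ j' * u'"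
    "\<not> int p dvd fps_nth u' 0" "[v' * fps_nth u' 0 = fps_nth w' 0] (mod int p)"
    using assms(2) unfolding place_def by blast
  have den: "ieval (r * r') \<beta> \<approx> fps_X ^ (j + j') * (u * u')"
    using eqv_mult[OF 1(4) 2(4)] by (simp add: ieval_simps power_add mult_ac)
  have unit: "\<not> int p dvd fps_nth (u * u') 0"
    using 1(5) 2(5) prime_p by (simp add: prime_dvd_mult_iff)
  have num: "ieval (q * r' + q' * r) \<beta> \<approx> fps_X ^ (j + j') * (w * u' + w' * u)"
    using eqv_add[OF eqv_mult[OF 1(3) 2(4)] eqv_mult[OF 2(3) 1(4)]]
    by (simp add: ieval_simps power_add algebra_simps)
  show "place (x + y) (v + v')"
  proof (rule placeI[OF _ _ num den unit])
    have "[v * fps_nth u 0 * fps_nth u' 0 + v' * fps_nth u' 0 * fps_nth u 0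
        = fps_nth w 0 * fps_nth u' 0 + fps_nth w' 0 * fps_nth u 0] (mod int p)"
      by (intro cong_add cong_scalar_right 1(6) 2(6))
    thus "[(v + v') * fps_nth (u * u') 0 = fps_nth (w * u' + w' * u) 0] (mod int p)"
      by (simp add: algebra_simps)
  qed (use 1 2 in \<open>simp_all add: ieval_simps add_frac_eq\<close>)
  have num: "ieval (q * q') \<beta> \<approx> fps_X ^ (j + j') * (w * w')"
    using eqv_mult[OF 1(3) 2(3)] by (simp add: ieval_simps power_add mult_ac)
  show "place (x * y) (v * v')"
  proof (rule placeI[OF _ _ num den unit])
    show "[v * v' * fps_nth (u * u') 0 = fps_nth (w * w') 0] (mod int p)"
      using cong_mult[OF 1(6) 2(6)] by (simp add: mult_ac)
  qed (use 1 2 in \<open>simp_all add: ieval_simps\<close>)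
qed

text \<open>Valuation ring property: numerator and denominator are put in normal form and their
  exponents of \<open>X\<close> compared.\<close>

lemma place_total:
  assumes "x \<in> rat_adjoin \<alpha>"
  obtains v where "place x v" | "x \<noteq> 0" "place (inverse x) 0"
proof -
  obtain q r where qr: "ieval r \<alpha> \<noteq> 0" "x = ieval q \<alpha> / ieval r \<alpha>"
    using assms by (rule rat_adjoin_fraction)
  \<comment> \<open>If \<open>s\<close> vanished at \<beta>, the Bezout identity of \<open>F\<close>
    and \<open>s\<close> would make a nonzero integer vanish in the local ring.\<close>
  have nonzero: "\<not> ieval s \<beta> \<approx> 0" if s: "ieval s \<alpha> \<noteq> 0" for s
  proof
    assume s0: "ieval s \<beta> \<approx> 0"
    obtain A B m where m: "m \<noteq> 0" "A * F + B * s = [:m:]"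
      using irreducible_int_bezout[OF irred not_dvd_of_root_nonroot[OF root s]] by blast
    have "fps_const m = ieval (A * F + B * s) \<beta>"
      unfolding m(2) by (simp add: ieval_pCons of_int_fps)
    also have "\<dots> \<approx> ieval A \<beta> * 0 + ieval B \<beta> * 0"
      unfolding ieval_simps by (intro eqv_add eqv_mult local_root s0 eqv_refl)
    finally show False using m(1) eqv_const_0 by simp
  qed
  show ?thesis
  proof (cases "ieval q \<alpha> = 0")
    case True
    thus ?thesis using qr place_of_int[of 0] that(1) by simp
  next
    case False
    obtain i w where w: "ieval q \<beta> \<approx> fps_X ^ i * w" "\<not> int p dvd fps_nth w 0"
      by (rule eqv_normal_form[of "ieval q \<beta>"]) (use nonzero[OF False] in auto)
    obtain j u where u: "ieval r \<beta> \<approx> fps_X ^ j * u" "\<not> int p dvd fps_nth u 0"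
      by (rule eqv_normal_form[of "ieval r \<beta>"]) (use nonzero[OF qr(1)] in auto)
    show ?thesis
    proof (cases "j \<le> i")
      case True
      define w' where "w' = fps_X ^ (i - j) * w"
      have w': "ieval q \<beta> \<approx> fps_X ^ j * w'"
        using w(1) True by (simp add: w'_def mult.assoc[symmetric] power_add[symmetric])
      have "coprime (fps_nth u 0) (int p)"
        using u(2) prime_p by (metis coprime_commute prime_imp_coprime prime_nat_int_transfer)
      then obtain s where s: "[fps_nth u 0 * s = 1] (mod int p)" using cong_solve_coprime_int by blast
      have "[fps_nth w' 0 * s * fps_nth u 0 = fps_nth w' 0] (mod int p)"
        using cong_scalar_left[OF s, of "fps_nth w' 0"] by (simp add: mult_ac)
      thus ?thesis using placeI[OF qr w' u] that(1) by blast
    next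
      case False
      define u' where "u' = fps_X ^ (j - i) * u"
      have u': "ieval r \<beta> \<approx> fps_X ^ i * u'"
        using u(1) False by (simp add: u'_def mult.assoc[symmetric] power_add[symmetric])
      \<comment> \<open>As \<open>j > i\<close>, a positive power of \<open>X\<close> remains in
        \<open>u'\<close> and its constant coefficient is 0.\<close>
      have "[0 * fps_nth w 0 = fps_nth u' 0] (mod int p)"
        using False by (simp add: u'_def)
      hence "place (inverse x) 0"
        using placeI[OF \<open>ieval q \<alpha> \<noteq> 0\<close> _ u' w] qr(2) by (simp add: inverse_divide)
      moreover have "x \<noteq> 0" using qr \<open>ieval q \<alpha> \<noteq> 0\<close> by simp
      ultimately show ?thesis using that(2) by blast
    qed
  qed
qed

text \<open>If \<open>x\<close> were not finite, \<open>inverse x\<close> would have residue 0. The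
  reversed monic relation vanishes at \<open>inverse x\<close>, yet its residue is the old leading
  coefficient 1.\<close>

lemma place_integral:
  assumes "x \<in> ring_of_integers (rat_adjoin \<alpha>)"
  shows "\<exists>v. place x v"
proof -
  have "x \<in> rat_adjoin \<alpha>" "algebraic_int x"
    using assms by (auto simp: ring_of_integers_def)
  from this(1) show ?thesis
  proof (rule place_total)
    assume x: "x \<noteq> 0" "place (inverse x) 0"
    obtain h where h: "ieval h x = 0" "lead_coeff h = 1"
      using \<open>algebraic_int x\<close> unfolding algebraic_int_altdef_ipoly by blast
    have "place (ieval (reflect_poly h) (inverse x)) (poly (reflect_poly h) 0)"
      by (rule ieval_closed[where P = place]) (auto intro: place_of_int place_add_mult x(2))
    moreover have "map_poly of_int (reflect_poly h) = (reflect_poly (map_poly of_int h) :: 'a poly)"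
      by (intro poly_eqI) (simp add: coeff_reflect_poly coeff_map_poly)
    hence "ieval (reflect_poly h) (inverse x) = 0"
      using poly_reflect_poly_nz[of "inverse x" "map_poly of_int h"] x(1) h(1) by simp
    ultimately have "place 0 1" using h(2) by (simp add: poly_0_coeff_0)
    hence "[1 = 0] (mod int p)" using place_unique place_of_int[of 0] by fastforce
    hence False using not_prime_unit[of "int p"] prime_p by (simp add: cong_0_iff)
    thus ?thesis ..
  qed auto
qed

lemma residue_place: "residue_place p (ring_of_integers (rat_adjoin \<alpha>)) place"
  unfolding residue_place_def
  using place_unique place_of_int place_add_mult place_integral by blast

end

section \<open>The trinomial\<close>

lemma is_subfield_rat_adjoin: "is_subfield (rat_adjoin \<alpha>)"
  unfolding rat_adjoin_def by (rule hull_in) (auto simp: is_subfield_def)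

lemma rat_adjoin_base: "\<alpha> \<in> rat_adjoin \<alpha>"
  unfolding rat_adjoin_def using hull_subset[of "{\<alpha>}" is_subfield] by simp

lemma is_subfield_of_int:
  assumes "is_subfield L"
  shows "of_int m \<in> L"
proof -
  have nat: "of_nat i \<in> L" for i
    using assms by (induction i) (auto simp: is_subfield_def)
  show ?thesis
    using nat[of "nat m"] nat[of "nat (- m)"] assms by (cases "m \<ge> 0") (auto simp: is_subfield_def)
qed

lemma is_subfield_ieval: "is_subfield L \<Longrightarrow> x \<in> L \<Longrightarrow> ieval q x \<in> L"
proof (induction q)
  case 0
  thus ?case by (simp add: is_subfield_def)
next
  case (pCons a q)
  thus ?case using is_subfield_of_int[of L a] by (simp add: ieval_pCons is_subfield_def)
qed

lemma is_subfield_divide: "is_subfield L \<Longrightarrow> x \<in> L \<Longrightarrow> y \<in> L \<Longrightarrow> x / y \<in> L"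
  by (simp add: is_subfield_def divide_inverse)

text \<open>By the pigeonhole principle, \<theta> has the same residue at two of the
  \<open>p + 1\<close> places. The difference of their residue maps is the function required by
  \<open>prime_dvd_add_index\<close>.\<close>

lemma prime_dvd_index_of_places:
  fixes L :: "'a::field_char_0 set" and p :: nat
  defines "A \<equiv> ring_of_integers L"
  assumes "prime p" and L: "is_subfield L"
    and P: "\<And>i. i \<le> p \<Longrightarrow> residue_place p A (P i)"
    and sep: "\<And>i j. i < j \<Longrightarrow> j \<le> p \<Longrightarrow> \<exists>x\<in>A. \<exists>v w. P i x v \<and> P j x w \<and> \<not> [v = w] (mod int p)"
    and \<theta>: "\<theta> \<in> A"
  shows "p dvd add_index A (int_adjoin \<theta>)"
proof -
  have A_add: "x + y \<in> A" if "x \<in> A" "y \<in> A" for x y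
    using that L by (auto simp: A_def ring_of_integers_def is_subfield_def algebraic_int_add)
  have B: "int_adjoin \<theta> \<subseteq> A"
    using \<theta> L by (auto simp: int_adjoin_def A_def ring_of_integers_def
        intro: algebraic_int_ieval is_subfield_ieval)
  have "0 \<in> int_adjoin \<theta>" unfolding int_adjoin_def by (rule range_eqI[of _ _ 0]) simp
  have "\<forall>i. \<exists>v. i \<le> p \<longrightarrow> P i \<theta> v" using residue_placeD(5)[OF P \<theta>] by blast
  then obtain v where v: "\<And>i. i \<le> p \<Longrightarrow> P i \<theta> (v i)" by metis
  have "(\<lambda>i. v i mod int p) ` {..p} \<subseteq> {0..<int p}"
    using prime_gt_0_nat[OF \<open>prime p\<close>] by auto
  hence "card ((\<lambda>i. v i mod int p) ` {..p}) \<le> p"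
    using card_mono[of "{0..<int p}" "(\<lambda>i. v i mod int p) ` {..p}"] by simp
  hence "\<not> inj_on (\<lambda>i. v i mod int p) {..p}" by (intro pigeonhole) simp
  then obtain i j where ij: "i < j" "j \<le> p" "[v i = v j] (mod int p)"
    unfolding inj_on_def cong_def by (metis atMost_iff linorder_neqE_nat)
  hence "i \<le> p" by simp
  \<comment> \<open>Residues are arbitrary chosen representatives, so \<open>res\<close> is additive
    only mod \<open>p\<close>.\<close>
  define res where "res = (\<lambda>i x. SOME u. P i x u)"
  have res: "P l x (res l x)" if "l \<le> p" "x \<in> A" for l x
    unfolding res_def using residue_placeD(5)[OF P[OF that(1)] that(2)] by (rule someI_ex)
  have res_eq: "[res l x = u] (mod int p)" if "l \<le> p" "x \<in> A" "P l x u" for l x u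
    using residue_placeD(1)[OF P[OF that(1)] res[OF that(1,2)] that(3)] .
  have res_add: "[res l (x + y) = res l x + res l y] (mod int p)" if "l \<le> p" "x \<in> A" "y \<in> A" for l x y
    using that by (intro res_eq A_add residue_placeD(3)[OF P] res)
  define \<psi> where "\<psi> = (\<lambda>x. res i x - res j x)"
  obtain x s t where x: "x \<in> A" "P i x s" "P j x t" "\<not> [s = t] (mod int p)"
    using sep[OF ij(1,2)] by blast
  show ?thesis
  proof (rule prime_dvd_add_index[OF \<open>prime p\<close> A_add B \<open>0 \<in> int_adjoin \<theta>\<close>])
    fix y z assume "y \<in> A" "z \<in> A"
    hence "[res i (y + z) - res j (y + z) = (res i y + res i z) - (res j y + res j z)] (mod int p)"
      using ij(2) \<open>i \<le> p\<close> by (intro cong_diff res_add)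
    thus "[\<psi> (y + z) = \<psi> y + \<psi> z] (mod int p)" by (simp add: \<psi>_def algebra_simps)
  next
    fix y assume "y \<in> int_adjoin \<theta>"
    then obtain q where q: "y = ieval q \<theta>" by (auto simp: int_adjoin_def)
    have "P l y (poly q (v l))" if "l \<le> p" for l
      unfolding q
      by (rule ieval_closed[where P = "P l"]) (auto intro: residue_placeD[OF P[OF that]] v[OF that])
    hence "[\<psi> y = poly q (v i) - poly q (v j)] (mod int p)"
      unfolding \<psi>_def using ij(2) \<open>i \<le> p\<close> B \<open>y \<in> int_adjoin \<theta>\<close> by (intro cong_diff res_eq) auto
    moreover have "[poly q (v i) = poly q (v j)] (mod int p)"
      using ij(3) by (induction q) (auto intro: cong_add cong_mult)
    ultimately show "[\<psi> y = 0] (mod int p)"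
      by (meson cong_diff_iff_cong_0 cong_trans)
  next
    show "x \<in> A" by fact
    have "[\<psi> x = s - t] (mod int p)"
      unfolding \<psi>_def using ij(2) \<open>i \<le> p\<close> x by (intro cong_diff res_eq)
    thus "\<not> [\<psi> x = 0] (mod int p)"
      using x(4) by (meson cong_diff_iff_cong_0 cong_sym cong_trans)
  qed
qed

lemma cong_power_1_of_dvd:
  fixes r p d :: nat
  assumes "prime p" "\<not> p dvd r" "(p - 1) dvd d"
  shows "[int r ^ d = 1] (mod int p)"
proof -
  obtain l where "d = (p - 1) * l" using assms(3) by (auto simp: dvd_def)
  moreover have "[(r ^ (p - 1)) ^ l = 1 ^ l] (mod p)"
    using assms(1,2) by (intro cong_pow fermat_theorem)
  ultimately have "[r ^ d = 1] (mod p)" by (simp add: power_mult)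
  thus ?thesis using cong_int_iff[of "r ^ d" 1 p] by simp
qed

section \<open>The trinomial setting and its places\<close>

locale trinomial_field =
  fixes n k p :: nat and a b :: int and \<alpha> :: "'a::field_char_0"
  assumes k_pos: "k > 0" and kn: "2 * k < n"
    and irred: "irreducible (map_poly rat_of_int (trinomial n (2 * k) a b))"
    and root: "ieval (trinomial n (2 * k) a b) \<alpha> = 0"
    and prime_p: "prime p" and odd_p: "odd p"
    and not_dvd: "\<not> p dvd 2 * k * (n - 2 * k)"
    and dvd: "(p - 1) dvd (n - 2 * k)"
    and val: "multiplicity (int p) b \<ge> 1" "even (multiplicity (int p) b)"
    and cong: "[a = - prime_free_part p b] (mod int p)" "[- prime_free_part p b = - 1] (mod int p)"
begin

abbreviation "F \<equiv> trinomial n (2 * k) a b"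
abbreviation "OK \<equiv> ring_of_integers (rat_adjoin \<alpha>)"
abbreviation "b' \<equiv> prime_free_part p b"

definition "m = multiplicity (int p) b div 2"
definition "m' = m div gcd m k"
definition "k' = k div gcd m k"
text \<open>The cofactor in the relation \<open>\<alpha> ^ (2 * k) * \<tau> = - b\<close>.\<close>

definition "\<tau> = \<alpha> ^ (n - 2 * k) + of_int a"
text \<open>At the ramified places \<alpha> has valuation \<open>m' / k'\<close> relative to
  \<open>p\<close> and \<tau> has residue -1, so \<delta> has nonzero residue there.\<close>

definition "\<delta> = \<alpha> ^ k' * \<tau> / of_int (int p ^ m')"

lemma b_eq: "b = int p ^ (2 * m) * b'"
  using val(2) multiplicity_dvd[of "int p" b] by (simp add: m_def prime_free_part_def)

lemma m_pos: "m > 0"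
  using val by (auto simp: m_def elim!: evenE)

text \<open>Lowest terms exclude that \<open>m'\<close> and \<open>k'\<close> are both even. This
  parity later yields two ramified places where \<delta> has opposite residues.\<close>

lemma mk: "m = gcd m k * m'" "k = gcd m k * k'" "m' > 0" "k' > 0" "odd m' \<or> odd k'"
proof -
  show "m = gcd m k * m'" "k = gcd m k * k'" by (simp_all add: m'_def k'_def)
  thus "m' > 0" "k' > 0" using m_pos k_pos by (metis gr0I mult_0_right less_irrefl)+
  have "coprime m' k'" unfolding m'_def k'_def using k_pos by (intro div_gcd_coprime) auto
  thus "odd m' \<or> odd k'" using coprime_common_divisor[of m' k' 2] by auto
qed

lemma a_cong: "[a = - 1] (mod int p)"
  using cong cong_trans by blast

lemma ab_cong: "int p dvd a + b'"
  using cong(1) by (simp add: cong_iff_dvd_diff)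

lemma p_dvd_b: "int p dvd b"
  using val(1) multiplicity_dvd'[of 1 "int p" b] by simp

lemma not_dvd_int: "\<not> int p dvd 2 * int k" "\<not> int p dvd int n - 2 * int k"
proof -
  show "\<not> int p dvd 2 * int k"
    using not_dvd by (metis dvd_mult2 int_dvd_int_iff of_nat_mult of_nat_numeral)
  have "\<not> p dvd n - 2 * k" using not_dvd by auto
  thus "\<not> int p dvd int n - 2 * int k"
    using kn by (metis int_dvd_int_iff less_imp_le of_nat_diff of_nat_mult of_nat_numeral)
qed

lemma ieval_F: "ieval F x = x ^ n + of_int a * x ^ (2 * k) + of_int b"
  by (simp add: trinomial_def ieval_simps)

lemma \<alpha>_OK: "\<alpha> \<in> OK"
proof -
  have "degree (Polynomial.monom a (2 * k) + [:b:]) < n"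
    using kn by (intro degree_add_less) (auto intro: le_less_trans[OF Polynomial.degree_monom_le])
  hence "degree F = n"
    unfolding trinomial_def by (subst add.assoc, subst degree_add_eq_left) (auto simp: Polynomial.degree_monom_eq)
  hence "lead_coeff F = 1" using kn by (simp add: trinomial_def coeff_pCons split: nat.splits)
  hence "algebraic_int \<alpha>" unfolding algebraic_int_altdef_ipoly using root by blast
  thus ?thesis using rat_adjoin_base by (simp add: ring_of_integers_def)
qed

text \<open>With \<open>g = gcd m k\<close>, the power \<open>\<delta> ^ (2 * g)\<close> contains
  \<open>\<alpha> ^ (2 * k) * \<tau> = - b\<close> over \<open>p ^ (2 * m)\<close>. The powers of
  \<open>p\<close> cancel exactly and leave \<open>- b' * \<tau> ^ (2 * g - 1)\<close>, which is
  integral.\<close>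

lemma \<delta>_OK: "\<delta> \<in> OK"
proof -
  define g where "g = gcd m k"
  have "\<alpha> ^ (2 * k) * \<tau> = \<alpha> ^ n + of_int a * \<alpha> ^ (2 * k)"
    using kn by (simp add: \<tau>_def algebra_simps power_add[symmetric])
  also have "\<dots> = - of_int b" using root by (simp add: ieval_F eq_neg_iff_add_eq_0)
  finally have rel: "\<alpha> ^ (2 * k) * \<tau> = - of_int b" .
  have g: "g > 0" using k_pos by (simp add: g_def)
  have "2 * (g * k') = 2 * k" "2 * (g * m') = 2 * m"
    unfolding g_def by (simp_all only: mk(1,2)[symmetric])
  hence e: "k' * (2 * g) = 2 * k" "m' * (2 * g) = 2 * m" by (simp_all only: mult_ac)
  have "\<delta> ^ (2 * g) = \<alpha> ^ (2 * k) * \<tau> ^ (2 * g) / of_int (int p ^ (2 * m))"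
    unfolding \<delta>_def power_divide power_mult_distrib of_int_power power_mult[symmetric] e ..
  also have "\<tau> ^ (2 * g) = \<tau> * \<tau> ^ (2 * g - 1)" using g by (simp add: power_eq_if)
  also have "\<alpha> ^ (2 * k) * (\<tau> * \<tau> ^ (2 * g - 1)) = - of_int b * \<tau> ^ (2 * g - 1)"
    by (simp only: mult.assoc[symmetric] rel)
  also have "of_int b = of_int (int p ^ (2 * m)) * (of_int b' :: 'a)"
    by (subst b_eq) (simp only: of_int_mult)
  also have "- (of_int (int p ^ (2 * m)) * of_int b') * \<tau> ^ (2 * g - 1) / of_int (int p ^ (2 * m))
      = - of_int b' * \<tau> ^ (2 * g - 1)"
    using prime_gt_0_nat[OF prime_p] by simp
  also have "\<dots> = ieval ([:- b':] * (Polynomial.monom 1 (n - 2 * k) + [:a:]) ^ (2 * g - 1)) \<alpha>"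
    by (simp add: ieval_simps \<tau>_def)
  finally have "algebraic_int (\<delta> ^ (2 * g))"
    using \<alpha>_OK by (simp add: ring_of_integers_def algebraic_int_ieval)
  hence "algebraic_int \<delta>"
    by (rule algebraic_int_root[of _ "Polynomial.monom 1 (2 * g)"])
      (use g in \<open>auto simp: Polynomial.poly_monom Polynomial.degree_monom_eq\<close>)
  moreover have "\<delta> \<in> rat_adjoin \<alpha>"
  proof -
    have "\<delta> = ieval (Polynomial.monom 1 k' * (Polynomial.monom 1 (n - 2 * k) + [:a:])) \<alpha> / of_int (int p ^ m')"
      by (simp add: \<delta>_def \<tau>_def ieval_simps)
    thus ?thesis
      using is_subfield_divide[OF is_subfield_rat_adjoin is_subfield_ieval is_subfield_of_int]
        is_subfield_rat_adjoin rat_adjoin_base by metis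
  qed
  ultimately show ?thesis by (simp add: ring_of_integers_def)
qed

text \<open>For \<open>e = c = 1\<close> the local ring is the ring of p-adic integers. Modulo
  \<open>p\<close>, Fermat's theorem makes \<open>r\<close> a root of \<open>F\<close>, and
  \<open>hensel\<close> lifts it.\<close>

lemma unit_place:
  assumes "0 < r" "r < p"
  shows "\<exists>P. residue_place p OK P \<and> P \<alpha> (int r)"
proof -
  interpret ramified_ring p 1 1 using prime_p by unfold_locales auto
  define G :: "int fps poly" where "G = Polynomial.monom 1 n + Polynomial.monom (of_int a) (2 * k) + [:of_int b:]"
  have "\<not> p dvd r" using assms by (auto dest: dvd_imp_le)
  have fermat: "[int r ^ (n - 2 * k) = 1] (mod int p)"
    using prime_p \<open>\<not> p dvd r\<close> dvd by (rule cong_power_1_of_dvd)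
  have "[int r ^ (2 * k) * int r ^ (n - 2 * k) + a * int r ^ (2 * k) + b
      = int r ^ (2 * k) * 1 + (- 1) * int r ^ (2 * k) + 0] (mod int p)"
    using fermat a_cong p_dvd_b by (intro cong_add cong_mult cong_refl) (auto simp: cong_0_iff)
  hence "int p dvd int r ^ (2 * k) * int r ^ (n - 2 * k) + a * int r ^ (2 * k) + b"
    by (simp add: cong_0_iff)
  also have "int r ^ (2 * k) * int r ^ (n - 2 * k) = int r ^ n"
    using kn by (simp add: power_add[symmetric])
  finally have 1: "int p dvd fps_nth (poly G (fps_const (int r))) 0"
    by (simp add: G_def Polynomial.poly_monom of_int_fps)
  \<comment> \<open>The derivative of \<open>F\<close> at \<open>r\<close>: splitting
    \<open>n - 1\<close> as \<open>(2 * k - 1) + (n - 2 * k)\<close> reduces it to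
    \<open>(n - 2 * k) * r ^ (2 * k - 1)\<close>, which is nonzero mod \<open>p\<close>.\<close>
  have "[int n * (int r ^ (2 * k - 1) * int r ^ (n - 2 * k)) + a * (2 * int k * int r ^ (2 * k - 1))
      = int n * (int r ^ (2 * k - 1) * 1) + (- 1) * (2 * int k * int r ^ (2 * k - 1))] (mod int p)"
    using fermat a_cong by (intro cong_add cong_mult cong_refl)
  moreover have "int r ^ (2 * k - 1) * int r ^ (n - 2 * k) = int r ^ (n - 1)"
    using kn k_pos by (simp add: power_add[symmetric])
  ultimately have d: "[int n * int r ^ (n - 1) + a * (2 * int k * int r ^ (2 * k - 1))
      = (int n - 2 * int k) * int r ^ (2 * k - 1)] (mod int p)"
    by (simp add: algebra_simps)
  have "\<not> int p dvd (int n - 2 * int k) * int r ^ (2 * k - 1)"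
    using not_dvd_int(2) \<open>\<not> p dvd r\<close> prime_p
    by (auto simp: prime_dvd_mult_iff dest!: prime_dvd_power[rotated])
  hence "\<not> int p dvd int n * int r ^ (n - 1) + a * (2 * int k * int r ^ (2 * k - 1))"
    by (simp only: cong_dvd_iff[OF d] not_False_eq_True)
  hence 2: "\<not> int p dvd fps_nth (poly (pderiv G) (fps_const (int r))) 0"
    by (simp add: G_def pderiv_add pderiv_monom Polynomial.poly_monom of_int_fps pderiv_pCons algebra_simps)
  obtain u where u: "eqv (poly G u) 0" "fps_nth u 0 = int r" using hensel[OF 1 2] by auto
  have "ieval F u = poly G u" by (simp add: ieval_F G_def Polynomial.poly_monom)
  hence "eqv (ieval F u) 0" using u(1) by simp
  then interpret local_root p 1 1 F \<alpha> u
    using irred root by unfold_locales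
  have "place \<alpha> (int r)" using place_ieval[of "[:0, 1:]"] u(2) by (simp add: ieval_pCons)
  thus ?thesis using residue_place by blast
qed

text \<open>The approximate root is \<open>u0 = \<plusminus>1\<close>, and
  \<open>c = \<plusminus>1\<close> selects the extension. Both signs enter the residue of \<delta>,
  so either can be used to flip it.\<close>

lemma ramified_place:
  assumes c: "c * c = 1" and u0: "u0 * u0 = 1"
  shows "\<exists>P. residue_place p OK P \<and> P \<alpha> 0 \<and> P \<delta> (- (c ^ m' * u0 ^ k'))"
proof -
  interpret ramified_ring p k' c using prime_p mk(4) c by unfold_locales auto
  \<comment> \<open>This is \<open>F\<close> after the substitution of \<open>X ^ m'\<close> times
    the variable, divided by \<open>X ^ (2 * k * m')\<close>.\<close>
  define G :: "int fps poly" where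
    "G = Polynomial.monom (fps_X ^ (m' * (n - 2 * k))) n + Polynomial.monom (of_int a) (2 * k) + [:of_int b':]"
  have pos: "m' * (n - 2 * k) > 0" using mk(3) kn by simp
  have "u0 ^ (2 * k) = 1" using u0 by (simp add: power_mult power2_eq_square)
  hence 1: "int p dvd fps_nth (poly G (fps_const u0)) 0"
    using pos ab_cong by (simp add: G_def Polynomial.poly_monom of_int_fps)
  have "\<not> int p dvd a * (2 * int k * u0 ^ (2 * k - 1))"
  proof
    assume "int p dvd a * (2 * int k * u0 ^ (2 * k - 1))"
    \<comment> \<open>Multiplying by \<open>u0\<close> completes the power to
      \<open>u0 ^ (2 * k) = 1\<close>.\<close>
    hence "int p dvd (a * (2 * int k * u0 ^ (2 * k - 1))) * u0" by (rule dvd_mult2)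
    also have "(a * (2 * int k * u0 ^ (2 * k - 1))) * u0 = a * (2 * int k * u0 ^ (2 * k))"
      using k_pos by (simp add: power_eq_if)
    finally have "int p dvd a * (2 * int k)" using \<open>u0 ^ (2 * k) = 1\<close> by simp
    moreover have "\<not> int p dvd a"
      using a_cong not_prime_unit[of "int p"] prime_p by (auto simp: cong_dvd_iff)
    ultimately show False using not_dvd_int(1) prime_p by (simp add: prime_dvd_mult_iff)
  qed
  hence 2: "\<not> int p dvd fps_nth (poly (pderiv G) (fps_const u0)) 0"
    using pos
    by (simp add: G_def pderiv_add pderiv_monom Polynomial.poly_monom of_int_fps pderiv_pCons algebra_simps)
  obtain u where u: "eqv (poly G u) 0" "fps_nth u 0 = u0" using hensel[OF 1 2] by auto
  define \<beta> where "\<beta> = fps_X ^ m' * u"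
  have exps: "m' * n = 2 * k * m' + m' * (n - 2 * k)" "k' * (2 * m) = 2 * k * m'"
  proof -
    have "n = 2 * k + (n - 2 * k)" using kn by simp
    hence "m' * n = m' * (2 * k + (n - 2 * k))" by simp
    thus "m' * n = 2 * k * m' + m' * (n - 2 * k)" by (simp add: algebra_simps)
    have "k' * (2 * m) = k' * (2 * (gcd m k * m'))" using mk(1) by simp
    also have "\<dots> = 2 * (gcd m k * k') * m'" by (simp only: mult_ac)
    finally show "k' * (2 * m) = 2 * k * m'" using mk(2) by simp
  qed
  have "of_int b = fps_const (int p) ^ (2 * m) * fps_const b'"
    by (subst b_eq) (simp only: of_int_fps fps_const_power fps_const_mult)
  also have "eqv \<dots> ((fps_const c * fps_X ^ k') ^ (2 * m) * fps_const b')"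
    by (intro eqv_mult eqv_power eqv_prime eqv_refl)
  also have "\<dots> = fps_const (c ^ (2 * m)) * fps_X ^ (k' * (2 * m)) * fps_const b'"
    by (simp only: power_mult_distrib fps_const_power power_mult[symmetric])
  \<comment> \<open>The valuation of \<open>b\<close> is even, so the sign \<open>c\<close> drops
    out of the constant term.\<close>
  also have "c ^ (2 * m) = 1" using c by (simp add: power_mult power2_eq_square)
  finally have b: "eqv (of_int b) (fps_X ^ (2 * k * m') * of_int b')"
    unfolding exps(2) of_int_fps by simp
  have "eqv (ieval F \<beta>) (\<beta> ^ n + of_int a * \<beta> ^ (2 * k) + fps_X ^ (2 * k * m') * of_int b')"
    unfolding ieval_F by (intro eqv_add b eqv_refl)
  also have "\<dots> = fps_X ^ (2 * k * m') * poly G u"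
  proof -
    have "\<beta> ^ n = fps_X ^ (2 * k * m') * (fps_X ^ (m' * (n - 2 * k)) * u ^ n)"
      unfolding \<beta>_def power_mult_distrib power_mult[symmetric] exps(1) power_add by (simp only: mult.assoc)
    moreover have "\<beta> ^ (2 * k) = fps_X ^ (2 * k * m') * u ^ (2 * k)"
      unfolding \<beta>_def power_mult_distrib power_mult[symmetric] by (simp only: mult_ac)
    ultimately show ?thesis by (simp add: G_def Polynomial.poly_monom algebra_simps)
  qed
  also have "eqv \<dots> (fps_X ^ (2 * k * m') * 0)" by (intro eqv_mult u(1) eqv_refl)
  finally have "eqv (ieval F \<beta>) 0" by simp
  then interpret local_root p k' c F \<alpha> \<beta>
    using irred root by unfold_locales
  have \<beta>0: "fps_nth \<beta> 0 = 0" using mk(3) by (simp add: \<beta>_def)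
  have "place \<alpha> 0" using place_ieval[of "[:0, 1:]"] \<beta>0 by (simp add: ieval_pCons)
  \<comment> \<open>Numerator and denominator of \<delta> both carry \<open>X ^ (m' * k')\<close>.
    What remains has residues \<open>u0 ^ k' * a\<close> and \<open>c ^ m'\<close>, where
    \<open>a\<close> is -1 mod \<open>p\<close> and \<open>c ^ m'\<close> is its own
    inverse.\<close>
  moreover have "place \<delta> (- (c ^ m' * u0 ^ k'))"
  proof (rule placeI)
    show "ieval [:int p ^ m':] \<alpha> \<noteq> 0" using prime_gt_0_nat[OF prime_p] by (simp add: ieval_pCons)
    show "\<delta> = ieval (Polynomial.monom 1 k' * (Polynomial.monom 1 (n - 2 * k) + [:a:])) \<alpha> / ieval [:int p ^ m':] \<alpha>"
      by (simp add: \<delta>_def \<tau>_def ieval_simps)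
    have "ieval (Polynomial.monom 1 k' * (Polynomial.monom 1 (n - 2 * k) + [:a:])) \<beta>
        = fps_X ^ (m' * k') * (u ^ k' * (\<beta> ^ (n - 2 * k) + of_int a))"
      by (simp add: ieval_simps \<beta>_def power_mult_distrib power_mult mult.assoc)
    thus "eqv (ieval (Polynomial.monom 1 k' * (Polynomial.monom 1 (n - 2 * k) + [:a:])) \<beta>) (fps_X ^ (m' * k') * (u ^ k' * (\<beta> ^ (n - 2 * k) + of_int a)))" by simp
    have "ieval [:int p ^ m':] \<beta> = fps_const (int p) ^ m'"
      by (simp add: ieval_pCons of_int_fps)
    also have "eqv \<dots> ((fps_const c * fps_X ^ k') ^ m')" by (intro eqv_power eqv_prime)
    also have "\<dots> = fps_X ^ (m' * k') * fps_const (c ^ m')"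
      by (simp add: power_mult_distrib power_mult[symmetric] mult_ac)
    finally show "eqv (ieval [:int p ^ m':] \<beta>) (fps_X ^ (m' * k') * fps_const (c ^ m'))" .
    have cc: "c ^ m' * c ^ m' = 1" using c by (simp add: power_mult_distrib[symmetric])
    show "\<not> int p dvd fps_nth (fps_const (c ^ m')) 0"
    proof
      assume "int p dvd fps_nth (fps_const (c ^ m')) 0"
      hence "int p dvd c ^ m' * c ^ m'" by (intro dvd_mult) simp
      thus False using cc not_prime_unit[of "int p"] prime_p by simp
    qed
    have "- (c ^ m' * u0 ^ k') * c ^ m' = - ((c ^ m' * c ^ m') * u0 ^ k')" by (simp only: algebra_simps)
    also have "\<dots> = u0 ^ k' * (- 1)" by (simp add: cc)
    also have "[u0 ^ k' * (- 1) = u0 ^ k' * a] (mod int p)"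
      using a_cong by (intro cong_mult cong_refl) (rule cong_sym)
    also have "u0 ^ k' * a = fps_nth (u ^ k' * (\<beta> ^ (n - 2 * k) + of_int a)) 0"
      using \<beta>0 kn u(2) by (simp add: of_int_fps fps_nth_power_0)
    finally show "[- (c ^ m' * u0 ^ k') * fps_nth (fps_const (c ^ m')) 0
        = fps_nth (u ^ k' * (\<beta> ^ (n - 2 * k) + of_int a)) 0] (mod int p)" by simp
  qed
  ultimately show ?thesis using residue_place by blast
qed

text \<open>Indices 0 and \<open>p\<close> carry the two ramified places, the others the unit
  places. The residue of \<alpha> separates every pair except \<open>0, p\<close>, and \<delta>
  separates that one.\<close>

lemma separated_places:
  obtains P where "\<And>i. i \<le> p \<Longrightarrow> residue_place p OK (P i)"
    "\<And>i j. i < j \<Longrightarrow> j \<le> p \<Longrightarrow> \<exists>x\<in>OK. \<exists>v w. P i x v \<and> P j x w \<and> \<not> [v = w] (mod int p)"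
proof -
  obtain Q where Q: "residue_place p OK Q" "Q \<alpha> 0" "Q \<delta> (- 1)"
    using ramified_place[of 1 1] by auto
  \<comment> \<open>For odd \<open>k'\<close> the root starting at \<open>u0 = - 1\<close> changes
    the sign. Otherwise \<open>m'\<close> is odd, and the extension with \<open>c = - 1\<close>
    does.\<close>
  obtain Q' where Q': "residue_place p OK Q'" "Q' \<alpha> 0" "Q' \<delta> 1"
  proof (cases "odd k'")
    case True
    thus ?thesis using ramified_place[of 1 "- 1"] that by auto
  next
    case False
    thus ?thesis using ramified_place[of "- 1" 1] mk(5) that by auto
  qed
  obtain U where U: "\<And>r. 0 < r \<Longrightarrow> r < p \<Longrightarrow> residue_place p OK (U r) \<and> U r \<alpha> (int r)"
    using unit_place by metis
  define P where "P = (\<lambda>i. if i = 0 then Q else if i = p then Q' else U i)"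
  have "residue_place p OK (P i)" if "i \<le> p" for i
    using that Q Q' U by (auto simp: P_def)
  moreover have "\<exists>x\<in>OK. \<exists>v w. P i x v \<and> P j x w \<and> \<not> [v = w] (mod int p)" if "i < j" "j \<le> p" for i j
  proof (cases "i = 0 \<and> j = p")
    case True
    \<comment> \<open>Oddness of \<open>p\<close> keeps the residues -1 and 1 of \<delta>
      apart.\<close>
    have "p > 2" using odd_p prime_ge_2_nat[OF prime_p] by (cases "p = 2") auto
    hence "\<not> [- 1 = 1] (mod int p)" by (auto simp: cong_iff_dvd_diff dest: zdvd_imp_le)
    thus ?thesis using True Q Q' \<delta>_OK prime_gt_0_nat[OF prime_p] by (auto simp: P_def)
  next
    case False
    \<comment> \<open>The residues of \<alpha>; index \<open>p\<close> has residue 0, as it carries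
      a ramified place.\<close>
    define v where "v = (\<lambda>l. if l = p then 0 else int l)"
    have "P l \<alpha> (v l)" if "l \<le> p" for l
      using that Q Q' U by (auto simp: P_def v_def)
    moreover have "\<not> [v i = v j] (mod int p)"
      using that False by (auto simp: v_def cong_def)
    ultimately show ?thesis using \<alpha>_OK that by (metis less_imp_le less_le_trans)
  qed
  ultimately show ?thesis by (rule that)
qed

lemma prime_dvd_index:
  assumes "\<theta> \<in> OK"
  shows "p dvd add_index OK (int_adjoin \<theta>)"
proof (rule separated_places)
  fix P assume P: "\<And>i. i \<le> p \<Longrightarrow> residue_place p OK (P i)"
    "\<And>i j. i < j \<Longrightarrow> j \<le> p \<Longrightarrow> \<exists>x\<in>OK. \<exists>v w. P i x v \<and> P j x w \<and> \<not> [v = w] (mod int p)"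
  show ?thesis
    by (rule prime_dvd_index_of_places[where P = P, OF prime_p is_subfield_rat_adjoin])
      (fact P assms)+
qed

lemma prime_dvd_field_index: "p dvd field_index (rat_adjoin \<alpha>)"
  unfolding field_index_def using prime_dvd_index by (intro Gcd_greatest) blast

text \<open>If \<open>OK\<close> equals \<open>int_adjoin \<theta>\<close>, all cosets coincide and
  the index is 1, which \<open>p\<close> does not divide.\<close>

lemma not_monogenic: "\<not> monogenic (rat_adjoin \<alpha>)"
proof
  assume "monogenic (rat_adjoin \<alpha>)"
  then obtain \<theta> where \<theta>: "\<theta> \<in> OK" "OK = int_adjoin \<theta>" by (auto simp: monogenic_def)
  have "x +o int_adjoin \<theta> = int_adjoin \<theta>" if x: "x \<in> int_adjoin \<theta>" for x
  proof (intro Set.set_eqI iffI)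
    obtain q where q: "x = ieval q \<theta>" using x by (auto simp: int_adjoin_def)
    fix y
    show "y \<in> int_adjoin \<theta>" if y: "y \<in> x +o int_adjoin \<theta>"
    proof -
      obtain r where "y = ieval (q + r) \<theta>"
        using y q by (auto simp: elt_set_plus_def int_adjoin_def ieval_add)
      thus ?thesis by (auto simp: int_adjoin_def)
    qed
    show "y \<in> x +o int_adjoin \<theta>" if y: "y \<in> int_adjoin \<theta>"
    proof -
      obtain r where "y = x + ieval (r - q) \<theta>"
        using y q by (auto simp: int_adjoin_def ieval_diff)
      thus ?thesis by (auto simp: elt_set_plus_def int_adjoin_def)
    qed
  qed
  hence "(\<lambda>x. x +o int_adjoin \<theta>) ` OK = {int_adjoin \<theta>}" using \<theta> by auto
  hence "add_index OK (int_adjoin \<theta>) = 1" by (simp add: add_index_def)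
  thus False using prime_dvd_index[OF \<theta>(1)] prime_p by (simp add: not_prime_1)
qed

end

theorem theorem2p3:
  fixes n k p :: nat and a b :: int and \<alpha> :: "'a::field_char_0"
  assumes "n > 0" and "k > 0" and "2 * k < n"
    and "irreducible (map_poly rat_of_int (trinomial n (2 * k) a b))"
    and "poly (map_poly of_int (trinomial n (2 * k) a b)) \<alpha> = 0"
    and "prime p" and "odd p"
    and "\<not> p dvd 2 * k * (n - 2 * k)"
    and "(p - 1) dvd (n - 2 * k)"
    and "multiplicity (int p) b \<ge> 1" and "even (multiplicity (int p) b)"
    and "[a = - prime_free_part p b] (mod int p)"
    and "[- prime_free_part p b = - 1] (mod int p)"
  shows "p dvd field_index (rat_adjoin \<alpha>) \<and> \<not> monogenic (rat_adjoin \<alpha>)"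
proof -
  interpret trinomial_field n k p a b \<alpha>
    using assms by unfold_locales
  show ?thesis using prime_dvd_field_index not_monogenic by blast
qed

end
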